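(* Let $W$ be a group with a finite generating set $S=\{s_1,\dots,s_k\}$, and let $(V_1,\rho_1)$, $(V_2,\rho_2)$ be irreducible reflection representations of $(W,S)$ over a field $\mathbb{F}$ of characteristic $0$, of dimensions $n_1$ and $n_2$. Suppose $\bigwedge^{d_1}V_1\simeq\bigwedge^{d_2}V_2$ as $W$-modules for some integers $d_1,d_2$ with $1\le d_\iota\le n_\iota-1$ for $\iota=1,2$. Then $d_1=d_2$, $n_1=n_2$, and $V_1\simeq V_2$ as $W$-modules.
   Context: A linear map $s:V\to V$ on a finite-dimensional $\mathbb{F}$-vector space is called a (generalized) reflection if $s$ is diagonalizable and $\operatorname{rank}(s-\operatorname{Id}_V)=1$. A representation $(V,\rho)$ of $W$ on a finite-dimensional $\mathbb{F}$-vector space is a reflection representation of $(W,S)$ if $\rho(s_i)$ is a reflection on $V$ for every $i\in\{1,\dots,k\}$. The group $W$ acts on $\bigwedge^d V$ by $w\cdot(v_1\wedge\cdots\wedge v_d)=(w v_1)\wedge\cdots\wedge(w v_d)$. *)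

theory Defs
  imports "HOL-Algebra.Generated_Groups" "Jordan_Normal_Form.DL_Rank_Submatrix"
begin

definition is_rep :: "('g, 'b) monoid_scheme \<Rightarrow> nat \<Rightarrow> ('g \<Rightarrow> 'a::field mat) \<Rightarrow> bool" where
  "is_rep W n \<rho> \<longleftrightarrow>
     (\<forall>w\<in>carrier W. \<rho> w \<in> carrier_mat n n) \<and>
     \<rho> \<one>\<^bsub>W\<^esub> = 1\<^sub>m n \<and>
     (\<forall>x\<in>carrier W. \<forall>y\<in>carrier W. \<rho> (x \<otimes>\<^bsub>W\<^esub> y) = \<rho> x * \<rho> y)"

definition invariant_subspace :: "('g, 'b) monoid_scheme \<Rightarrow> nat \<Rightarrow> ('g \<Rightarrow> 'a::field mat) \<Rightarrow> 'a vec set \<Rightarrow> bool" where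
  "invariant_subspace W n \<rho> U \<longleftrightarrow>
     U \<subseteq> carrier_vec n \<and> 0\<^sub>v n \<in> U \<and>
     (\<forall>u\<in>U. \<forall>v\<in>U. u + v \<in> U) \<and> (\<forall>c. \<forall>u\<in>U. c \<cdot>\<^sub>v u \<in> U) \<and>
     (\<forall>w\<in>carrier W. \<forall>u\<in>U. \<rho> w *\<^sub>v u \<in> U)"

definition irreducible_rep :: "('g, 'b) monoid_scheme \<Rightarrow> nat \<Rightarrow> ('g \<Rightarrow> 'a::field mat) \<Rightarrow> bool" where
  "irreducible_rep W n \<rho> \<longleftrightarrow> is_rep W n \<rho> \<and> n > 0 \<and>
     (\<forall>U. invariant_subspace W n \<rho> U \<longrightarrow> U = {0\<^sub>v n} \<or> U = carrier_vec n)"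

definition is_reflection :: "nat \<Rightarrow> 'a::field mat \<Rightarrow> bool" where
  "is_reflection n A \<longleftrightarrow> A \<in> carrier_mat n n \<and>
     (\<exists>D. diagonal_mat D \<and> similar_mat A D) \<and>
     vec_space.rank n (A - 1\<^sub>m n) = 1"

definition reflection_rep :: "('g, 'b) monoid_scheme \<Rightarrow> 'g set \<Rightarrow> nat \<Rightarrow> ('g \<Rightarrow> 'a::field mat) \<Rightarrow> bool" where
  "reflection_rep W S n \<rho> \<longleftrightarrow> is_rep W n \<rho> \<and> (\<forall>s\<in>S. is_reflection n (\<rho> s))"

definition iso_rep :: "('g, 'b) monoid_scheme \<Rightarrow> nat \<Rightarrow> ('g \<Rightarrow> 'a::field mat) \<Rightarrow> nat \<Rightarrow> ('g \<Rightarrow> 'a mat) \<Rightarrow> bool" where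
  "iso_rep W n1 \<rho>1 n2 \<rho>2 \<longleftrightarrow>
     (\<exists>P. P \<in> carrier_mat n2 n1 \<and> invertible_mat P \<and>
          (\<forall>w\<in>carrier W. P * \<rho>1 w = \<rho>2 w * P))"

text \<open>Exterior power. The basis of the d-th exterior power of F^n consists of the
wedges e_I = e_{i_1} \<and> ... \<and> e_{i_d} for strictly increasing index lists
i_1 < ... < i_d below n; these lists are enumerated by wedge_basis n d.
The induced map A(v_1 \<and> ... \<and> v_d) = A v_1 \<and> ... \<and> A v_d sends e_J to
the sum over I of det(A[I,J]) e_I, so its matrix is the d-th compound matrix.\<close>
definition wedge_basis :: "nat \<Rightarrow> nat \<Rightarrow> nat list list" where
  "wedge_basis n d = filter (\<lambda>xs. length xs = d) (subseqs [0..<n])"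

definition ext_pow_mat :: "nat \<Rightarrow> nat \<Rightarrow> 'a::comm_ring_1 mat \<Rightarrow> 'a mat" where
  "ext_pow_mat n d A =
     (let L = wedge_basis n d
      in mat (length L) (length L)
           (\<lambda>(i, j). det (submatrix A (set (L ! i)) (set (L ! j)))))"

definition ext_pow_dim :: "nat \<Rightarrow> nat \<Rightarrow> nat" where
  "ext_pow_dim n d = length (wedge_basis n d)"

definition ext_pow_rep :: "nat \<Rightarrow> nat \<Rightarrow> ('g \<Rightarrow> 'a::comm_ring_1 mat) \<Rightarrow> 'g \<Rightarrow> 'a mat" where
  "ext_pow_rep n d \<rho> = (\<lambda>w. ext_pow_mat n d (\<rho> w))"

end

theory Submission
  imports Defs
begin

text \<open>
  A reflection is \<open>s = 1 + u f\<close> with \<open>u\<close> a vector, \<open>f\<close> a covector and \<open>f(u) \<noteq> 0\<close>. Since \<open>u f\<close> has rank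
  one, \<open>s - 1\<close> acts on the exterior power exactly as the element \<open>u f\<close> of the Lie algebra \<open>gl(V)\<close>
  does, that is, as a derivation. An isomorphism \<open>P\<close> of exterior powers therefore intertwines the Lie
  algebra elements \<open>u_i f_i\<close> and \<open>u'_i f'_i\<close>. Squares and traces of these operators show that
  \<open>f_i(u_i) = f'_i(u'_i)\<close> and that two pairs of binomial coefficients agree, which forces equal degrees
  and dimensions. As \<open>gl(V)\<close> acts faithfully on the exterior power in question, conjugation by \<open>P\<close> then
  restricts to an isomorphism \<open>L\<close> between Lie subalgebras of \<open>gl(V_1)\<close> and \<open>gl(V_2)\<close>. Brackets of the \<open>u_i f_i\<close> and
  irreducibility put every \<open>u_i f_j\<close> into the domain of \<open>L\<close>, with image a nonzero multiple of
  \<open>u'_i f'_j\<close>. Fixing \<open>j\<close>, the linear map \<open>q\<close> with \<open>L(v f_j) = q(v) f'_j\<close> is an isomorphism of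
  representations.
\<close>

section \<open>Creation and annihilation operators\<close>

text \<open>The dimension of the exterior power cannot tell \<open>d\<close> from
  \<open>n - d\<close>; the trace of \<open>u f\<close>, which is
  \<open>(n - 1) choose (d - 1)\<close> times \<open>f(u)\<close>, can. Comparing traces compares
  binomials only once the values \<open>f_i(u_i)\<close> are known to agree. Nothing says that
  \<open>P\<close> is induced by a map between \<open>V_1\<close> and \<open>V_2\<close>; such a map
  has to be recovered from the way \<open>P\<close> conjugates rank one elements. There, brackets
  determine the image of \<open>u_i f_j\<close> only up to a scalar \<open>t_ij\<close>, and the
  core of the argument is that these scalars are coherent: \<open>t_ik = t_ij t_jk\<close> and
  \<open>f_k(u_i) t_kj = t_ij f'_k(u'_i)\<close>. The second law is what makes
  \<open>q(u_i) = t_ij u'_i\<close> commute with the reflections. Coefficients in such identities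
  are read off by linear independence, which fails when distinct generators have parallel
  \<open>u_i\<close>. Parallelism is therefore expressed as the vanishing of a Lie algebra element,
  so that it transfers.\<close>

text \<open>
  A vector of the exterior algebra of \<open>F\<^sup>n\<close> is represented by its coefficient function \<open>h\<close> on index
  sets. \<open>create a\<close> is the wedge product with \<open>e_a\<close> from the left, \<open>annihilate b\<close> the contraction with
  the dual basis covector of \<open>e_b\<close>.
\<close>

definition sgn_pos :: "nat \<Rightarrow> nat set \<Rightarrow> 'a::comm_ring_1" where
  "sgn_pos a K = (-1) ^ card {x\<in>K. x < a}"

definition create :: "nat \<Rightarrow> (nat set \<Rightarrow> 'a::comm_ring_1) \<Rightarrow> nat set \<Rightarrow> 'a" where
  "create a h K = (if a \<in> K then sgn_pos a K * h (K - {a}) else 0)"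

definition annihilate :: "nat \<Rightarrow> (nat set \<Rightarrow> 'a::comm_ring_1) \<Rightarrow> nat set \<Rightarrow> 'a" where
  "annihilate b h K = (if b \<notin> K then sgn_pos b K * h (insert b K) else 0)"

lemma sgn_pos_insert:
  assumes "a \<notin> K"
  shows "sgn_pos c (insert a K) = (if a < c then - sgn_pos c K else sgn_pos c K)"
proof -
  have "{x \<in> insert a K. x < c} = (if a < c then insert a {x\<in>K. x < c} else {x\<in>K. x < c})"
    by auto
  then show ?thesis using assms by (simp add: sgn_pos_def)
qed

lemma sgn_pos_remove:
  assumes "a \<in> K"
  shows "sgn_pos c (K - {a}) = (if a < c then - sgn_pos c K else sgn_pos c K)"
  using sgn_pos_insert[of a "K - {a}" c] assms by (metis Diff_iff insertCI insert_Diff minus_minus)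

lemma sgn_pos_square [simp]: "sgn_pos a K * sgn_pos a K = 1"
  by (simp add: sgn_pos_def flip: power_add)

lemma sgn_pos_square_left [simp]: "sgn_pos a K * (sgn_pos a K * x) = x"
  by (simp flip: mult.assoc)

text \<open>Removing the smaller index first changes the sign attached to the larger one and not
  conversely, so the two orders differ by one sign; for \<open>a = c\<close> both sides
  vanish.\<close>

lemma create_create: "create a (create c h) K = - create c (create a h) K"
proof -
  have "K - {a} - {c} = K - {c} - {a}" by auto
  then show ?thesis
    by (cases "a = c"; cases "a < c") (simp_all add: create_def sgn_pos_remove)
qed

lemma annihilate_annihilate: "annihilate a (annihilate c h) K = - annihilate c (annihilate a h) K"
  by (cases "a = c"; cases "a < c")
    (simp_all add: annihilate_def sgn_pos_insert insert_commute[of a c])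

text \<open>The canonical anticommutation relation; it moves annihilators to the right of
  creators.\<close>

lemma annihilate_create:
  "annihilate b (create c h) K = (if b = c then h K else 0) - create c (annihilate b h) K"
proof (cases "b = c")
  case True
  then show ?thesis
    by (simp add: annihilate_def create_def sgn_pos_insert sgn_pos_remove insert_absorb)
next
  case False
  then have "insert b K - {c} = insert b (K - {c})" by auto
  with False show ?thesis
    by (cases "b < c") (simp_all add: annihilate_def create_def sgn_pos_insert sgn_pos_remove)
qed

lemma create_sum: "create a (\<lambda>K. \<Sum>i\<in>I. g i K) K = (\<Sum>i\<in>I. create a (g i) K)"
  by (simp add: create_def sum_distrib_left)

lemma annihilate_sum: "annihilate a (\<lambda>K. \<Sum>i\<in>I. g i K) K = (\<Sum>i\<in>I. annihilate a (g i) K)"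
  by (simp add: annihilate_def sum_distrib_left)

lemma create_mult: "create a (\<lambda>K. c * g K) K = c * create a g K"
  by (simp add: create_def)

lemma annihilate_mult: "annihilate a (\<lambda>K. c * g K) K = c * annihilate a g K"
  by (simp add: annihilate_def)

lemma create_diff: "create a (\<lambda>K. g K - h K) K = create a g K - create a h K"
  by (simp add: create_def algebra_simps)

lemma create_delta: "create a (\<lambda>K. if P then g K else 0) K = (if P then create a g K else 0)"
  by (simp add: create_def)

lemma create_uminus: "create a (\<lambda>K. - g K) K = - create a g K"
  by (simp add: create_def)

section \<open>Derivations of the exterior algebra and normal ordering\<close>

definition mmul :: "nat \<Rightarrow> (nat \<Rightarrow> nat \<Rightarrow> 'a::comm_ring_1) \<Rightarrow> (nat \<Rightarrow> nat \<Rightarrow> 'a) \<Rightarrow> nat \<Rightarrow> nat \<Rightarrow> 'a" where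
  "mmul n X Y i j = (\<Sum>k<n. X i k * Y k j)"

text \<open>The derivation of the exterior algebra that extends the matrix \<open>X\<close>, in
  second-quantized form.\<close>

definition ext_der :: "nat \<Rightarrow> (nat \<Rightarrow> nat \<Rightarrow> 'a::comm_ring_1) \<Rightarrow> (nat set \<Rightarrow> 'a) \<Rightarrow> nat set \<Rightarrow> 'a" where
  "ext_der n X h K = (\<Sum>a<n. \<Sum>b<n. X a b * create a (annihilate b h) K)"

text \<open>The normally ordered part of a product of two derivations, all creators on the left. It
  measures how far \<open>ext_der\<close> is from being multiplicative.\<close>

definition ext_der2 :: "nat \<Rightarrow> (nat \<Rightarrow> nat \<Rightarrow> 'a::comm_ring_1) \<Rightarrow> (nat \<Rightarrow> nat \<Rightarrow> 'a) \<Rightarrow> (nat set \<Rightarrow> 'a) \<Rightarrow> nat set \<Rightarrow> 'a" where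
  "ext_der2 n X Y h K = (\<Sum>a<n. \<Sum>b<n. \<Sum>c<n. \<Sum>d<n.
     X a b * Y c d * create a (create c (annihilate b (annihilate d h))) K)"

lemma create_annihilate_create_annihilate:
  "create a (annihilate b (create c (annihilate d h))) K =
     (if b = c then create a (annihilate d h) K else 0) - create a (create c (annihilate b (annihilate d h))) K"
  by (simp add: annihilate_create[abs_def] create_diff create_delta)

lemma ext_der_ext_der:
  "ext_der n X (ext_der n Y h) K = ext_der n (mmul n X Y) h K - ext_der2 n X Y h K"
proof -
  have "ext_der n X (ext_der n Y h) K = (\<Sum>a<n. \<Sum>b<n. \<Sum>c<n. \<Sum>d<n.
     X a b * Y c d * create a (annihilate b (create c (annihilate d h))) K)"
    by (simp add: ext_der_def[abs_def] create_sum annihilate_sum create_mult annihilate_mult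
        annihilate_sum[abs_def] annihilate_mult[abs_def] sum_distrib_left mult.assoc)
  also have "\<dots> = (\<Sum>a<n. \<Sum>b<n. \<Sum>c<n. \<Sum>d<n.
     (if b = c then X a b * Y c d * create a (annihilate d h) K else 0)) - ext_der2 n X Y h K"
    unfolding create_annihilate_create_annihilate ext_der2_def sum_subtractf[symmetric]
    by (intro sum.cong refl) (simp add: algebra_simps)
  also have "(\<Sum>a<n. \<Sum>b<n. \<Sum>c<n. \<Sum>d<n.
     (if b = c then X a b * Y c d * create a (annihilate d h) K else 0)) =
     (\<Sum>a<n. \<Sum>b<n. \<Sum>d<n. \<Sum>c<n.
     (if b = c then X a b * Y c d * create a (annihilate d h) K else 0))"
    by (intro sum.cong refl sum.swap)
  also have "\<dots> = (\<Sum>a<n. \<Sum>b<n. \<Sum>d<n. X a b * Y b d * create a (annihilate d h) K)"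
    by simp
  also have "\<dots> = (\<Sum>a<n. \<Sum>d<n. \<Sum>b<n. X a b * Y b d * create a (annihilate d h) K)"
    by (intro sum.cong refl sum.swap)
  also have "\<dots> = ext_der n (mmul n X Y) h K"
    by (simp add: ext_der_def mmul_def sum_distrib_right)
  finally show ?thesis .
qed

lemma create_create_annihilate_annihilate:
  "create a (create c (annihilate b (annihilate d h))) K
     = create c (create a (annihilate d (annihilate b h))) K"
proof -
  have "annihilate b (annihilate d h) = (\<lambda>K. - annihilate d (annihilate b h) K)"
    by (rule ext) (rule annihilate_annihilate)
  then show ?thesis
    by (simp add: create_create[of a c] create_uminus create_uminus[abs_def])
qed

text \<open>Exchanging the two index pairs swaps the creators and also the annihilators, so two
  signs cancel. Hence this part drops out of commutators.\<close>

lemma ext_der2_commute: "ext_der2 n X Y h K = ext_der2 n Y X h K"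
proof -
  let ?t = "\<lambda>a b c d. X a b * Y c d * create a (create c (annihilate b (annihilate d h))) K"
  have "ext_der2 n X Y h K = (\<Sum>p\<in>{..<n}\<times>{..<n}. \<Sum>q\<in>{..<n}\<times>{..<n}. ?t (fst p) (snd p) (fst q) (snd q))"
    by (simp add: ext_der2_def sum.cartesian_product')
  also have "\<dots> = (\<Sum>q\<in>{..<n}\<times>{..<n}. \<Sum>p\<in>{..<n}\<times>{..<n}. ?t (fst p) (snd p) (fst q) (snd q))"
    by (rule sum.swap)
  also have "\<dots> = (\<Sum>q\<in>{..<n}\<times>{..<n}. \<Sum>p\<in>{..<n}\<times>{..<n}.
      Y (fst q) (snd q) * X (fst p) (snd p) *
      create (fst q) (create (fst p) (annihilate (snd q) (annihilate (snd p) h))) K)"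
    by (subst create_create_annihilate_annihilate) (simp add: mult_ac)
  also have "\<dots> = ext_der2 n Y X h K"
    by (simp add: ext_der2_def sum.cartesian_product')
  finally show ?thesis .
qed

definition outer :: "(nat \<Rightarrow> 'a::comm_ring_1) \<Rightarrow> (nat \<Rightarrow> 'a) \<Rightarrow> nat \<Rightarrow> nat \<Rightarrow> 'a" where
  "outer u f i j = u i * f j"

text \<open>The factor \<open>u a * u c\<close> is symmetric while the creators anticommute, so the
  sum is its own negative. This is \<open>u \<and> u = 0\<close> in coordinates.\<close>

lemma ext_der2_outer:
  fixes u f :: "nat \<Rightarrow> 'a::field_char_0"
  shows "ext_der2 n (outer u f) (outer u f) h K = 0"
proof -
  define t where "t a c = (\<Sum>b<n. \<Sum>d<n. u a * f b * (u c * f d) *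
    create a (create c (annihilate b (annihilate d h))) K)" for a c
  have "t a c = - t c a" for a c
    unfolding t_def create_create[of a c] sum_negf[symmetric]
    by (intro sum.cong refl) (simp add: mult_ac)
  then have "(\<Sum>a<n. \<Sum>c<n. t a c) = (\<Sum>a<n. \<Sum>c<n. - t c a)"
    by (metis (no_types, lifting) sum.cong)
  also have "\<dots> = - (\<Sum>c<n. \<Sum>a<n. t c a)"
    by (subst sum.swap) (simp add: sum_negf)
  finally have "(\<Sum>a<n. \<Sum>c<n. t a c) = 0"
    by (simp add: equal_neg_zero)
  moreover have "ext_der2 n (outer u f) (outer u f) h K = (\<Sum>a<n. \<Sum>c<n. t a c)"
    unfolding ext_der2_def outer_def t_def by (rule sum.cong[OF refl], rule sum.swap)
  ultimately show ?thesis by simp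
qed

section \<open>Determinants of rank one perturbations\<close>

definition replace_row :: "'a mat \<Rightarrow> nat \<Rightarrow> (nat \<Rightarrow> 'a) \<Rightarrow> 'a mat" where
  "replace_row A k w = mat (dim_row A) (dim_col A) (\<lambda>(i, j). if i = k then w j else A $$ (i, j))"

lemma replace_row_carrier [simp]:
  "A \<in> carrier_mat n m \<Longrightarrow> replace_row A k w \<in> carrier_mat n m"
  by (auto simp: replace_row_def)

lemma det_replace_row:
  fixes A :: "'a::comm_ring_1 mat"
  assumes A: "A \<in> carrier_mat n n" and k: "k < n"
  shows "det (replace_row A k w) = (\<Sum>j<n. w j * cofactor A k j)"
proof -
  have "mat_delete (replace_row A k w) k j = mat_delete A k j" for j
    using A by (intro eq_matI) (auto simp: mat_delete_def replace_row_def)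
  then show ?thesis
    using laplace_expansion_row[OF replace_row_carrier[OF A] k] A k
    by (simp add: cofactor_def replace_row_def)
qed

text \<open>Terms of second order in \<open>u\<close> would be determinants with two rows
  proportional to \<open>v\<close>, so only the first order survives.\<close>

lemma det_add_rank_one:
  fixes A :: "'a::comm_ring_1 mat"
  assumes "A \<in> carrier_mat n n"
  shows "det (mat n n (\<lambda>(i, j). A $$ (i, j) + u i * v j)) =
    det A + (\<Sum>i<n. \<Sum>j<n. u i * v j * cofactor A i j)"
proof -
  \<comment> \<open>Induction on a bound for the support of \<open>u\<close>: the last perturbed row
    is absorbed into the matrix, the rest is left to the induction hypothesis.\<close>
  have "det (mat n n (\<lambda>(i, j). A $$ (i, j) + u i * v j)) =
    det A + (\<Sum>i<k. u i * det (replace_row A i v))"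
    if "k \<le> n" "\<And>i. i \<ge> k \<Longrightarrow> u i = 0" "A \<in> carrier_mat n n" for k u A
    using that
  proof (induction k arbitrary: u A)
    case 0
    then have "mat n n (\<lambda>(i, j). A $$ (i, j) + u i * v j) = A"
      by (intro eq_matI) auto
    then show ?case by simp
  next
    case (Suc k)
    define A' where "A' = replace_row A k (\<lambda>j. A $$ (k, j) + u k * v j)"
    have A': "A' \<in> carrier_mat n n" using Suc.prems by (simp add: A'_def)
    have "mat n n (\<lambda>(i, j). A $$ (i, j) + u i * v j) =
      mat n n (\<lambda>(i, j). A' $$ (i, j) + (u(k := 0)) i * v j)"
      using Suc.prems by (intro eq_matI) (auto simp: A'_def replace_row_def)
    also have "det \<dots> = det A' + (\<Sum>i<k. (u(k := 0)) i * det (replace_row A' i v))"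
      using Suc.prems A' by (intro Suc.IH) (auto simp: le_Suc_eq not_less_eq_eq)
    also have "det A' = det A + u k * det (replace_row A k v)"
    proof -
      have "det A = (\<Sum>j<n. A $$ (k, j) * cofactor A k j)"
        using Suc.prems by (intro laplace_expansion_row) auto
      then show ?thesis
        unfolding A'_def using Suc.prems
        by (simp add: det_replace_row[of _ n] algebra_simps sum.distrib sum_distrib_left)
    qed
    also have "(\<Sum>i<k. (u(k := 0)) i * det (replace_row A' i v)) = (\<Sum>i<k. u i * det (replace_row A i v))"
    proof (rule sum.cong[OF refl])
      fix i assume "i \<in> {..<k}"
      then have i: "i < k" by simp
      \<comment> \<open>Row \<open>i\<close> is now \<open>v\<close>, so a row operation undoes the
        perturbation of row \<open>k\<close>; this is where the second order terms
        disappear.\<close>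
      have "replace_row A' i v = addrow (u k) k i (replace_row A i v)"
        using i Suc.prems by (intro eq_matI) (auto simp: A'_def replace_row_def algebra_simps)
      then have "det (replace_row A' i v) = det (replace_row A i v)"
        using i Suc.prems by (simp add: det_addrow[of _ n])
      then show "(u(k := 0)) i * det (replace_row A' i v) = u i * det (replace_row A i v)"
        using i by simp
    qed
    finally show ?case by (simp add: algebra_simps)
  qed
  from this[of n "\<lambda>i. if i < n then u i else 0" A] assms
  have "det (mat n n (\<lambda>(i, j). A $$ (i, j) + (if i < n then u i else 0) * v j)) =
    det A + (\<Sum>i<n. u i * det (replace_row A i v))"
    by simp
  moreover have "mat n n (\<lambda>(i, j). A $$ (i, j) + (if i < n then u i else 0) * v j) =
     mat n n (\<lambda>(i, j). A $$ (i, j) + u i * v j)"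
    by (intro eq_matI) auto
  ultimately show ?thesis
    using assms by (simp add: det_replace_row[of _ n] sum_distrib_left mult.assoc)
qed

text \<open>\<open>pick I k\<close> enumerates \<open>I\<close> increasingly from position 0, so
  deleting an element shifts only the later positions. This identifies minors of a submatrix with
  submatrices of the original.\<close>

lemma pick_remove:
  assumes "finite I" "i < card I" "k < card I - 1"
  shows "pick (I - {pick I i}) k = pick I (if k < i then k else Suc k)"
proof -
  let ?k = "if k < i then k else Suc k" and ?p = "pick I i"
  have k: "?k < card I" using assms by auto
  have lt: "pick I l < pick I m \<longleftrightarrow> l < m" if "l < card I" "m < card I" for l m
    using that pick_mono[of m I l] pick_mono[of l I m] by (cases l m rule: linorder_cases) auto
  have "card {a \<in> I - {?p}. a < pick I ?k} = k"
  proof -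
    have "{a \<in> I - {?p}. a < pick I ?k} = {a \<in> I. a < pick I ?k} - (if i < ?k then {?p} else {})"
      using lt[OF assms(2) k] by auto
    moreover have "card {a \<in> I. a < pick I ?k} = ?k" using card_pick k by blast
    moreover have "?p \<in> I" using pick_in_set assms by blast
    moreover have "?p < pick I ?k \<longleftrightarrow> i < ?k" using lt[OF assms(2) k] .
    ultimately show ?thesis using assms(1) by (auto simp: card_Diff_singleton_if)
  qed
  moreover have "pick I ?k \<in> I - {?p}"
    using k pick_in_set[of ?k I] lt[OF assms(2) k] lt[OF k assms(2)] by auto
  ultimately show ?thesis using pick_card_in_set by metis
qed

lemma pick_bij_betw:
  assumes "finite I"
  shows "bij_betw (pick I) {..<card I} I"
proof -
  have "inj_on (pick I) {..<card I}"
    by (rule linorder_inj_onI) (use pick_mono in force)+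
  moreover have "pick I ` {..<card I} \<subseteq> I" using pick_in_set by auto
  ultimately show ?thesis
    using assms by (simp add: bij_betw_def card_image card_subset_eq)
qed

lemma card_restrict_eq:
  "I \<subseteq> {..<m} \<Longrightarrow> card {i. i < m \<and> i \<in> I} = card I"
  by (rule arg_cong[of _ _ card]) auto

lemma submatrix_eq:
  assumes "A \<in> carrier_mat m n" "I \<subseteq> {..<m}" "J \<subseteq> {..<n}"
  shows "submatrix A I J = mat (card I) (card J) (\<lambda>(i, j). A $$ (pick I i, pick J j))"
  using assms by (simp add: submatrix_def card_restrict_eq)

lemma mat_delete_submatrix:
  assumes "A \<in> carrier_mat m n" "I \<subseteq> {..<m}" "J \<subseteq> {..<n}" "i < card I" "j < card J"
  shows "mat_delete (submatrix A I J) i j = submatrix A (I - {pick I i}) (J - {pick J j})"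
proof -
  have fin: "finite I" "finite J" using assms finite_subset by blast+
  have mem: "pick I i \<in> I" "pick J j \<in> J" using assms pick_in_set by auto
  have "submatrix A (I - {pick I i}) (J - {pick J j}) = mat (card I - 1) (card J - 1)
      (\<lambda>(k, l). A $$ (pick (I - {pick I i}) k, pick (J - {pick J j}) l))"
    using assms fin mem by (subst submatrix_eq[of A m n]) auto
  also have "\<dots> = mat_delete (submatrix A I J) i j"
    using assms fin
    by (intro eq_matI) (auto simp: mat_delete_def submatrix_eq[of A m n] pick_remove)
  finally show ?thesis by simp
qed

lemma det_submatrix_one:
  assumes "I \<subseteq> {..<n}" "J \<subseteq> {..<n}" "card I = card J"
  shows "det (submatrix (1\<^sub>m n :: 'a::comm_ring_1 mat) I J) = (if I = J then 1 else 0)"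
proof (cases "I = J")
  case True
  have "finite I" using assms finite_subset by blast
  then have inj: "pick I i = pick I j \<longleftrightarrow> i = j" if "i < card I" "j < card I" for i j
    using pick_bij_betw[of I] that by (auto simp: bij_betw_def inj_on_def)
  have "pick I i < n" if "i < card I" for i using pick_in_set[of i I] that assms by auto
  then have "submatrix (1\<^sub>m n :: 'a mat) I I = 1\<^sub>m (card I)"
    using inj by (intro eq_matI) (auto simp: submatrix_def card_restrict_eq[OF assms(1)])
  then show ?thesis using True by simp
next
  case False
  have fin: "finite I" "finite J" using assms finite_subset by blast+
  \<comment> \<open>The row of the identity with index \<open>a\<close> in \<open>I\<close> but not
    in \<open>J\<close> becomes a zero row.\<close>
  obtain a where a: "a \<in> I" "a \<notin> J"
    using False fin assms card_subset_eq[of J I] by blast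
  then obtain i where i: "i < card I" "pick I i = a"
    using bij_betw_imp_surj_on[OF pick_bij_betw[OF fin(1)]] by (metis imageE lessThan_iff)
  let ?M = "submatrix (1\<^sub>m n :: 'a mat) I J"
  have M: "?M \<in> carrier_mat (card I) (card I)"
    using assms by (simp add: submatrix_def card_restrict_eq)
  have "?M $$ (i, j) = 0" if "j < card J" for j
  proof -
    have "pick J j \<in> J" using that pick_in_set by blast
    then have "pick J j \<noteq> a" "pick J j < n" "a < n" using a assms by auto
    then show ?thesis using i that assms by (simp add: submatrix_def card_restrict_eq)
  qed
  then have "det ?M = 0"
    using laplace_expansion_row[OF M i(1)] assms by simp
  then show ?thesis using False by simp
qed

lemma sgn_pos_pick: "i < card I \<Longrightarrow> sgn_pos (pick I i) I = (-1) ^ i"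
  by (simp add: sgn_pos_def card_pick)

text \<open>The cofactors in the first order expansion are again minors of the identity, so only
  pairs with \<open>I - {a} = J - {b}\<close> contribute. The sum is arranged to match
  \<open>ext_der_single\<close>.\<close>

lemma det_submatrix_one_plus_outer:
  fixes u f :: "nat \<Rightarrow> 'a::comm_ring_1"
  assumes IJ: "I \<subseteq> {..<n}" "J \<subseteq> {..<n}" "card I = card J"
  shows "det (submatrix (1\<^sub>m n + mat n n (\<lambda>(i, j). outer u f i j)) I J) =
    (if I = J then 1 else 0) +
    (\<Sum>a\<in>I. \<Sum>b\<in>J. if I - {a} = J - {b} then u a * f b * (sgn_pos a I * sgn_pos b J) else 0)"
proof -
  have fin: "finite I" "finite J" using IJ finite_subset by blast+
  let ?d = "card I" and ?B = "submatrix (1\<^sub>m n :: 'a mat) I J"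
  have B: "?B \<in> carrier_mat ?d ?d"
    using IJ by (simp add: submatrix_def card_restrict_eq)
  have lt: "i < ?d \<Longrightarrow> pick I i < n" "i < ?d \<Longrightarrow> pick J i < n" for i
    using pick_in_set[of i I] pick_in_set[of i J] IJ by auto
  have "submatrix (1\<^sub>m n + mat n n (\<lambda>(i, j). outer u f i j)) I J =
    mat ?d ?d (\<lambda>(i, j). ?B $$ (i, j) + u (pick I i) * f (pick J j))"
    using IJ lt by (intro eq_matI) (auto simp: submatrix_def card_restrict_eq outer_def)
  then have "det (submatrix (1\<^sub>m n + mat n n (\<lambda>(i, j). outer u f i j)) I J) =
    det ?B + (\<Sum>i<?d. \<Sum>j<?d. u (pick I i) * f (pick J j) * cofactor ?B i j)"
    using det_add_rank_one[OF B] by simp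
  also have "(\<Sum>i<?d. \<Sum>j<?d. u (pick I i) * f (pick J j) * cofactor ?B i j) =
    (\<Sum>i<?d. \<Sum>j<?d. if I - {pick I i} = J - {pick J j}
       then u (pick I i) * f (pick J j) * (sgn_pos (pick I i) I * sgn_pos (pick J j) J) else 0)"
  proof (intro sum.cong refl)
    fix i j assume "i \<in> {..<?d}" "j \<in> {..<?d}"
    then have ij: "i < card I" "j < card J" using IJ by auto
    have "mat_delete ?B i j = submatrix (1\<^sub>m n) (I - {pick I i}) (J - {pick J j})"
      using ij IJ by (intro mat_delete_submatrix) auto
    moreover have "pick I i \<in> I" "pick J j \<in> J" using ij pick_in_set by auto
    then have "det (submatrix (1\<^sub>m n :: 'a mat) (I - {pick I i}) (J - {pick J j})) =
      (if I - {pick I i} = J - {pick J j} then 1 else 0)"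
      using IJ fin by (intro det_submatrix_one) auto
    ultimately show "u (pick I i) * f (pick J j) * cofactor ?B i j =
      (if I - {pick I i} = J - {pick J j}
       then u (pick I i) * f (pick J j) * (sgn_pos (pick I i) I * sgn_pos (pick J j) J) else 0)"
      using ij by (simp add: cofactor_def sgn_pos_pick power_add)
  qed
  also have "\<dots> = (\<Sum>i<?d. \<Sum>b\<in>J. if I - {pick I i} = J - {b}
       then u (pick I i) * f b * (sgn_pos (pick I i) I * sgn_pos b J) else 0)"
    using IJ by (intro sum.cong refl sum.reindex_bij_betw) (simp add: pick_bij_betw fin)
  also have "\<dots> = (\<Sum>a\<in>I. \<Sum>b\<in>J. if I - {a} = J - {b}
       then u a * f b * (sgn_pos a I * sgn_pos b J) else 0)"
    by (rule sum.reindex_bij_betw[where g = "\<lambda>a. \<Sum>b\<in>J. if I - {a} = J - {b}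
       then u a * f b * (sgn_pos a I * sgn_pos b J) else 0"]) (simp add: pick_bij_betw fin)
  finally show ?thesis using IJ by (simp add: det_submatrix_one)
qed

section \<open>The Lie algebra action on exterior powers\<close>

definition wedge_sets :: "nat \<Rightarrow> nat \<Rightarrow> nat set set" where
  "wedge_sets n d = {I. I \<subseteq> {..<n} \<and> card I = d}"

definition wedge_set :: "nat \<Rightarrow> nat \<Rightarrow> nat \<Rightarrow> nat set" where
  "wedge_set n d i = set (wedge_basis n d ! i)"

definition single :: "nat set \<Rightarrow> nat set \<Rightarrow> 'a::comm_ring_1" where
  "single J K = (if K = J then 1 else 0)"

definition ext_der_mat :: "nat \<Rightarrow> nat \<Rightarrow> (nat \<Rightarrow> nat \<Rightarrow> 'a::comm_ring_1) \<Rightarrow> 'a mat" where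
  "ext_der_mat n d X = mat (ext_pow_dim n d) (ext_pow_dim n d)
     (\<lambda>(i, j). ext_der n X (single (wedge_set n d j)) (wedge_set n d i))"

text \<open>Sums over matrix indices are turned into sums over \<open>d\<close>-sets through this
  bijection, which makes the order of the basis irrelevant.\<close>

lemma wedge_set_bij_betw: "bij_betw (wedge_set n d) {..<ext_pow_dim n d} (wedge_sets n d)"
proof -
  have dist: "distinct (map set (subseqs [0..<n]))"
    by (rule distinct_set_subseqs) simp
  have card: "card (set xs) = length xs" if "xs \<in> set (subseqs [0..<n])" for xs
    using subseqs_distinctD[OF that] by (simp add: distinct_card)
  define L where "L = map set (wedge_basis n d)"
  have "distinct L"
    unfolding L_def wedge_basis_def by (rule distinct_map_filter[OF dist])
  then have "bij_betw ((!) L) {..<length L} (set L)"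
    by (rule bij_betw_nth) simp_all
  moreover have "set L = wedge_sets n d"
  proof -
    have "set ` set (subseqs [0..<n]) = Pow {..<n}"
      by (simp only: subseqs_powset set_upt atLeast0LessThan)
    moreover have "set L = {I \<in> set ` set (subseqs [0..<n]). card I = d}"
      unfolding L_def wedge_basis_def using card by auto
    ultimately show ?thesis
      by (auto simp: wedge_sets_def)
  qed
  moreover have "length L = ext_pow_dim n d"
    by (simp add: L_def ext_pow_dim_def)
  ultimately have "bij_betw ((!) L) {..<ext_pow_dim n d} (wedge_sets n d)"
    by simp
  moreover have "L ! i = wedge_set n d i" if "i \<in> {..<ext_pow_dim n d}" for i
    using that by (simp add: L_def ext_pow_dim_def wedge_set_def)
  ultimately show ?thesis
    by (metis bij_betw_cong)
qed

lemma wedge_set_in: "i < ext_pow_dim n d \<Longrightarrow> wedge_set n d i \<in> wedge_sets n d"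
  using wedge_set_bij_betw[of n d] by (auto simp: bij_betw_def)

lemma wedge_set_eq_iff:
  "i < ext_pow_dim n d \<Longrightarrow> j < ext_pow_dim n d \<Longrightarrow> wedge_set n d i = wedge_set n d j \<longleftrightarrow> i = j"
  using wedge_set_bij_betw[of n d] by (auto simp: bij_betw_def inj_on_def)

lemma wedge_setE:
  assumes "I \<in> wedge_sets n d"
  obtains i where "i < ext_pow_dim n d" "wedge_set n d i = I"
  using bij_betw_imp_surj_on[OF wedge_set_bij_betw[of n d]] assms by (metis imageE lessThan_iff)

lemma finite_wedge_sets: "finite (wedge_sets n d)"
  using bij_betw_finite[OF wedge_set_bij_betw[of n d]] by simp

lemma ext_pow_dim_eq: "ext_pow_dim n d = n choose d"
  using bij_betw_same_card[OF wedge_set_bij_betw[of n d]] n_subsets[of "{..<n}" d]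
  by (simp add: wedge_sets_def)

text \<open>Annihilating and then creating preserves the degree: the value at \<open>I\<close>
  involves \<open>h\<close> only at sets \<open>insert b (I - {a})\<close>, which are
  \<open>d\<close>-sets again. This is what turns products of the matrices into compositions of
  operators.\<close>

lemma ext_der_expand:
  assumes "I \<in> wedge_sets n d"
  shows "ext_der n X h I = (\<Sum>K\<in>wedge_sets n d. ext_der n X (single K) I * h K)"
proof -
  have "create a (annihilate b h) I = (\<Sum>K\<in>wedge_sets n d. create a (annihilate b (single K)) I * h K)"
    if "b < n" for a b
  proof (cases "a \<in> I \<and> b \<notin> I - {a}")
    case True
    have "finite I" using assms finite_subset by (auto simp: wedge_sets_def)
    then have "insert b (I - {a}) \<in> wedge_sets n d"
      using True assms that card_Suc_Diff1[of I a]
      by (auto simp: wedge_sets_def card_insert_if simp del: card_Diff_insert)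
    moreover have "create a (annihilate b h) I =
       sgn_pos a I * sgn_pos b (I - {a}) * h (insert b (I - {a}))"
      using True by (simp add: create_def annihilate_def mult.assoc)
    moreover have "create a (annihilate b (single K)) I * h K =
      (if K = insert b (I - {a}) then sgn_pos a I * sgn_pos b (I - {a}) * h (insert b (I - {a})) else 0)" for K
      using True by (auto simp: create_def annihilate_def single_def)
    ultimately show ?thesis
      by (simp add: finite_wedge_sets)
  next
    case False
    then show ?thesis by (auto simp: create_def annihilate_def)
  qed
  then have "ext_der n X h I =
     (\<Sum>a<n. \<Sum>b<n. \<Sum>K\<in>wedge_sets n d. X a b * create a (annihilate b (single K)) I * h K)"
    by (simp add: ext_der_def sum_distrib_left mult.assoc)
  also have "\<dots> = (\<Sum>a<n. \<Sum>K\<in>wedge_sets n d. \<Sum>b<n. X a b * create a (annihilate b (single K)) I * h K)"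
    by (rule sum.cong[OF refl], rule sum.swap)
  also have "\<dots> = (\<Sum>K\<in>wedge_sets n d. \<Sum>a<n. \<Sum>b<n. X a b * create a (annihilate b (single K)) I * h K)"
    by (rule sum.swap)
  finally show ?thesis by (simp add: ext_der_def sum_distrib_right)
qed

lemma ext_der_single:
  assumes "I \<subseteq> {..<n}" "J \<subseteq> {..<n}"
  shows "ext_der n X (single J) I =
    (\<Sum>a\<in>I. \<Sum>b\<in>J. if I - {a} = J - {b} then X a b * (sgn_pos a I * sgn_pos b J) else 0)"
proof -
  let ?t = "\<lambda>a b. if I - {a} = J - {b} then X a b * (sgn_pos a I * sgn_pos b J) else 0"
  have "X a b * create a (annihilate b (single J)) I = (if a \<in> I then if b \<in> J then ?t a b else 0 else 0)" for a b
  proof (cases "a \<in> I \<and> b \<in> J \<and> I - {a} = J - {b}")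
    case True
    \<comment> \<open>The sign of \<open>b\<close> is taken at \<open>I - {a} = J - {b}\<close>; it
      counts smaller elements only, so the presence of \<open>b\<close> itself does not change
      it.\<close>
    then have "insert b (J - {b}) = J" by auto
    with True show ?thesis
      by (simp add: create_def annihilate_def single_def sgn_pos_remove)
  next
    case False
    then have "a \<in> I \<Longrightarrow> b \<notin> I - {a} \<Longrightarrow> insert b (I - {a}) \<noteq> J" by auto
    with False show ?thesis
      by (auto simp: create_def annihilate_def single_def)
  qed
  then have "ext_der n X (single J) I = (\<Sum>a<n. if a \<in> I then \<Sum>b<n. if b \<in> J then ?t a b else 0 else 0)"
    by (simp add: ext_der_def if_distrib[of "\<lambda>x. sum x _"] if_distribR cong: if_cong)
      (intro sum.cong refl, auto)
  also have "\<dots> = (\<Sum>a\<in>I. \<Sum>b\<in>J. ?t a b)"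
    using assms by (simp add: Int_absorb1 flip: sum.inter_restrict)
  finally show ?thesis .
qed

lemma ext_der_mat_carrier [simp]: "ext_der_mat n d X \<in> carrier_mat (ext_pow_dim n d) (ext_pow_dim n d)"
  by (simp add: ext_der_mat_def)

lemma ext_der_mat_dim [simp]:
  "dim_row (ext_der_mat n d X) = ext_pow_dim n d" "dim_col (ext_der_mat n d X) = ext_pow_dim n d"
  by (simp_all add: ext_der_mat_def)

lemma ext_der_mat_mult_index:
  assumes "i < ext_pow_dim n d" "j < ext_pow_dim n d"
  shows "(ext_der_mat n d X * ext_der_mat n d Y) $$ (i, j) =
    ext_der n X (ext_der n Y (single (wedge_set n d j))) (wedge_set n d i)"
proof -
  let ?h = "ext_der n Y (single (wedge_set n d j))"
  have "(ext_der_mat n d X * ext_der_mat n d Y) $$ (i, j) =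
    (\<Sum>k<ext_pow_dim n d. ext_der n X (single (wedge_set n d k)) (wedge_set n d i) * ?h (wedge_set n d k))"
    using assms by (simp add: ext_der_mat_def scalar_prod_def atLeast0LessThan)
  also have "\<dots> = (\<Sum>K\<in>wedge_sets n d. ext_der n X (single K) (wedge_set n d i) * ?h K)"
    by (rule sum.reindex_bij_betw[OF wedge_set_bij_betw])
  also have "\<dots> = ext_der n X ?h (wedge_set n d i)"
    by (rule ext_der_expand[symmetric]) (simp add: wedge_set_in assms)
  finally show ?thesis .
qed

section \<open>Lie brackets, rank one elements and faithfulness\<close>

definition bracket :: "nat \<Rightarrow> (nat \<Rightarrow> nat \<Rightarrow> 'a::comm_ring_1) \<Rightarrow> (nat \<Rightarrow> nat \<Rightarrow> 'a) \<Rightarrow> nat \<Rightarrow> nat \<Rightarrow> 'a" where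
  "bracket n X Y i j = mmul n X Y i j - mmul n Y X i j"

definition lincomb2 :: "'a::comm_ring_1 \<Rightarrow> (nat \<Rightarrow> nat \<Rightarrow> 'a) \<Rightarrow> 'a \<Rightarrow> (nat \<Rightarrow> nat \<Rightarrow> 'a) \<Rightarrow> nat \<Rightarrow> nat \<Rightarrow> 'a" where
  "lincomb2 r X s Y i j = r * X i j + s * Y i j"

lemma ext_der_lincomb2: "ext_der n (lincomb2 r X s Y) h K = r * ext_der n X h K + s * ext_der n Y h K"
  by (simp add: ext_der_def lincomb2_def sum_distrib_left sum.distrib algebra_simps)

lemma ext_der_mat_lincomb2:
  "ext_der_mat n d (lincomb2 r X s Y) = r \<cdot>\<^sub>m ext_der_mat n d X + s \<cdot>\<^sub>m ext_der_mat n d Y"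
  by (intro eq_matI) (auto simp: ext_der_mat_def ext_der_lincomb2)

lemma ext_der_bracket:
  "ext_der n (bracket n X Y) h K = ext_der n X (ext_der n Y h) K - ext_der n Y (ext_der n X h) K"
proof -
  have "ext_der n (bracket n X Y) h K = ext_der n (mmul n X Y) h K - ext_der n (mmul n Y X) h K"
    by (simp add: ext_der_def bracket_def left_diff_distrib sum_subtractf)
  then show ?thesis
    by (simp add: ext_der_ext_der ext_der2_commute[of n X Y])
qed

lemma ext_der_mat_bracket:
  "ext_der_mat n d (bracket n X Y) =
     ext_der_mat n d X * ext_der_mat n d Y - ext_der_mat n d Y * ext_der_mat n d X"
  by (intro eq_matI) (simp_all add: ext_der_mat_mult_index ext_der_bracket del: index_mult_mat(1),
    simp_all add: ext_der_mat_def ext_der_bracket)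

definition dot :: "nat \<Rightarrow> (nat \<Rightarrow> 'a::comm_ring_1) \<Rightarrow> (nat \<Rightarrow> 'a) \<Rightarrow> 'a" where
  "dot n f u = (\<Sum>k<n. f k * u k)"

text \<open>As matrices \<open>(u f)^2 = f(u) u f\<close>, and the normally ordered correction
  vanishes. This makes the scalar \<open>f(u)\<close> visible on the exterior power.\<close>

lemma ext_der_mat_outer_square:
  fixes u f :: "nat \<Rightarrow> 'a::field_char_0"
  shows "ext_der_mat n d (outer u f) * ext_der_mat n d (outer u f) = dot n f u \<cdot>\<^sub>m ext_der_mat n d (outer u f)"
proof -
  have "mmul n (outer u f) (outer u f) = (\<lambda>i j. dot n f u * outer u f i j)"
    by (intro ext) (simp add: mmul_def outer_def dot_def sum_distrib_left sum_distrib_right mult_ac)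
  then have "ext_der n (outer u f) (ext_der n (outer u f) h) K = dot n f u * ext_der n (outer u f) h K" for h K
    by (simp add: ext_der_ext_der ext_der2_outer)
      (simp add: ext_der_def sum_distrib_left mult.assoc)
  then show ?thesis
    by (intro eq_matI) (simp_all add: ext_der_mat_mult_index del: index_mult_mat(1), simp add: ext_der_mat_def)
qed

text \<open>The passage from group elements to Lie algebra elements: the minors of
  \<open>1 + u f\<close> have no terms beyond the first order.\<close>

lemma ext_pow_mat_one_plus_outer:
  fixes u f :: "nat \<Rightarrow> 'a::comm_ring_1"
  shows "ext_pow_mat n d (1\<^sub>m n + mat n n (\<lambda>(i, j). outer u f i j)) =
    1\<^sub>m (ext_pow_dim n d) + ext_der_mat n d (outer u f)"
proof (intro eq_matI)
  let ?N = "ext_pow_dim n d"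
  fix i j
  assume "i < dim_row (1\<^sub>m ?N + ext_der_mat n d (outer u f))" "j < dim_col (1\<^sub>m ?N + ext_der_mat n d (outer u f))"
  then have ij: "i < ?N" "j < ?N" by auto
  have in_sets: "wedge_set n d i \<in> wedge_sets n d" "wedge_set n d j \<in> wedge_sets n d"
    using ij by (auto intro: wedge_set_in)
  have "ext_pow_mat n d (1\<^sub>m n + mat n n (\<lambda>(i, j). outer u f i j)) $$ (i, j) =
    det (submatrix (1\<^sub>m n + mat n n (\<lambda>(i, j). outer u f i j)) (wedge_set n d i) (wedge_set n d j))"
    using ij by (simp add: ext_pow_mat_def wedge_set_def ext_pow_dim_def Let_def)
  also have "\<dots> = (1\<^sub>m ?N + ext_der_mat n d (outer u f)) $$ (i, j)"
    using in_sets ij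
    by (subst det_submatrix_one_plus_outer)
      (auto simp: wedge_sets_def ext_der_mat_def ext_der_single outer_def wedge_set_eq_iff cong: if_cong)
  finally show "ext_pow_mat n d (1\<^sub>m n + mat n n (\<lambda>(i, j). outer u f i j)) $$ (i, j) =
    (1\<^sub>m ?N + ext_der_mat n d (outer u f)) $$ (i, j)" .
qed (simp_all add: ext_pow_mat_def ext_pow_dim_def Let_def)

lemma ext_der_diag:
  assumes "I \<subseteq> {..<n}"
  shows "ext_der n X (single I) I = (\<Sum>a\<in>I. X a a)"
proof -
  have "finite I" using assms finite_subset by blast
  have eq: "I - {a} = I - {b} \<longleftrightarrow> a = b" if "a \<in> I" "b \<in> I" for a b
    using that by auto
  have "ext_der n X (single I) I = (\<Sum>a\<in>I. \<Sum>b\<in>I. if a = b then X a b else 0)"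
    unfolding ext_der_single[OF assms assms] by (intro sum.cong refl) (simp add: eq)
  also have "\<dots> = (\<Sum>a\<in>I. X a a)"
    using \<open>finite I\<close> by simp
  finally show ?thesis .
qed

text \<open>Faithfulness away from the ends: \<open>d < n\<close> leaves room for a set of size
  \<open>d - 1\<close> avoiding two given indices, and a scalar matrix acts as \<open>d\<close>
  times the scalar, which detects it because \<open>d\<close> is nonzero in characteristic
  0.\<close>

lemma ext_der_mat_eq_0_imp:
  fixes X :: "nat \<Rightarrow> nat \<Rightarrow> 'a::field_char_0"
  assumes d: "1 \<le> d" "d < n" and 0: "ext_der_mat n d X = 0\<^sub>m (ext_pow_dim n d) (ext_pow_dim n d)"
    and ab: "a < n" "b < n"
  shows "X a b = 0"
proof -
  have zero: "ext_der n X (single J) I = 0" if IJ: "I \<in> wedge_sets n d" "J \<in> wedge_sets n d" for I J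
  proof -
    obtain i where "i < ext_pow_dim n d" "wedge_set n d i = I"
      using wedge_setE[OF IJ(1)] .
    moreover obtain j where "j < ext_pow_dim n d" "wedge_set n d j = J"
      using wedge_setE[OF IJ(2)] .
    ultimately show ?thesis using arg_cong[OF 0, of "\<lambda>M. M $$ (i, j)"] by (simp add: ext_der_mat_def)
  qed
  have ex: "\<exists>K. K \<subseteq> {..<n} \<and> a \<notin> K \<and> b \<notin> K \<and> finite K \<and>
      insert a K \<in> wedge_sets n d \<and> insert b K \<in> wedge_sets n d"
    if ab: "a < n" "b < n" "a \<noteq> b" for a b
  proof -
    have "card ({..<n} - {a, b}) = n - 2" using ab by (simp add: card_Diff_subset)
    then have "d - 1 \<le> card ({..<n} - {a, b})" using d by auto
    then obtain K where K: "K \<subseteq> {..<n} - {a, b}" "card K = d - 1" "finite K"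
      by (rule obtain_subset_with_card_n)
    then have "a \<notin> K" "b \<notin> K" by auto
    with K show ?thesis using ab d by (intro exI[of _ K]) (auto simp: wedge_sets_def)
  qed
  \<comment> \<open>The entry at \<open>insert a K\<close>, \<open>insert b K\<close> is
    \<open>X a b\<close> up to sign.\<close>
  have offdiag: "X a b = 0" if ab: "a < n" "b < n" "a \<noteq> b" for a b
  proof -
    obtain K where K: "K \<subseteq> {..<n}" "a \<notin> K" "b \<notin> K" "finite K"
      "insert a K \<in> wedge_sets n d" "insert b K \<in> wedge_sets n d" using ex[OF ab] by blast
    let ?c = "X a b * (sgn_pos a (insert a K) * sgn_pos b (insert b K))"
    have eq: "insert a K - {x} = insert b K - {y} \<longleftrightarrow> x = a \<and> y = b"
      if "x \<in> insert a K" "y \<in> insert b K" for x y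
      using that K \<open>a \<noteq> b\<close> by auto
    have sub: "insert a K \<subseteq> {..<n}" "insert b K \<subseteq> {..<n}"
      using K ab by auto
    have "ext_der n X (single (insert b K)) (insert a K) =
      (\<Sum>x\<in>insert a K. \<Sum>y\<in>insert b K. if y = b then if x = a then ?c else 0 else 0)"
      unfolding ext_der_single[OF sub]
    proof (intro sum.cong refl)
      fix x y assume "x \<in> insert a K" "y \<in> insert b K"
      from eq[OF this] show "(if insert a K - {x} = insert b K - {y}
        then X x y * (sgn_pos x (insert a K) * sgn_pos y (insert b K)) else 0) =
        (if y = b then if x = a then ?c else 0 else 0)"
        by auto
    qed
    also have "\<dots> = (\<Sum>x\<in>insert a K. if x = a then ?c else 0)"
      using K(4) by (intro sum.cong refl, subst sum.delta) auto
    also have "\<dots> = ?c"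
      using K(4) by (subst sum.delta) auto
    finally have "X a b * (sgn_pos a (insert a K) * sgn_pos b (insert b K)) = 0"
      using zero K by simp
    then show ?thesis by (simp add: sgn_pos_def)
  qed
  \<comment> \<open>Two diagonal entries of the large matrix, at index sets that differ by
    exchanging \<open>a\<close> and \<open>b\<close>, are compared.\<close>
  have diag: "X a a = X b b" if ab: "a < n" "b < n" "a \<noteq> b" for a b
  proof -
    obtain K where K: "K \<subseteq> {..<n}" "a \<notin> K" "b \<notin> K" "finite K"
      "insert a K \<in> wedge_sets n d" "insert b K \<in> wedge_sets n d" using ex[OF ab] by blast
    then have "(\<Sum>x\<in>insert a K. X x x) = 0" "(\<Sum>x\<in>insert b K. X x x) = 0"
      using zero ext_der_diag[of "insert a K" n X] ext_der_diag[of "insert b K" n X]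
      by (auto simp: wedge_sets_def)
    then have "X a a + (\<Sum>x\<in>K. X x x) = X b b + (\<Sum>x\<in>K. X x x)" using K by simp
    then show ?thesis by simp
  qed
  have "X a a = 0"
  proof -
    obtain I where I: "I \<subseteq> {..<n}" "card I = d"
      using obtain_subset_with_card_n[of d "{..<n}"] d by auto
    then have "(\<Sum>x\<in>I. X x x) = 0" using zero[of I I] by (simp add: wedge_sets_def ext_der_diag)
    also have "(\<Sum>x\<in>I. X x x) = (\<Sum>x\<in>I. X a a)"
      using I ab diag by (intro sum.cong refl) (metis lessThan_iff subsetD)
    finally show ?thesis using I d by simp
  qed
  with offdiag ab show ?thesis by (cases "a = b") auto
qed

section \<open>Traces\<close>

definition mtrace :: "'a::comm_monoid_add mat \<Rightarrow> 'a" where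
  "mtrace A = (\<Sum>i<dim_row A. A $$ (i, i))"

lemma mtrace_mult_commute:
  fixes A B :: "'a::comm_semiring_0 mat"
  assumes "A \<in> carrier_mat n m" "B \<in> carrier_mat m n"
  shows "mtrace (A * B) = mtrace (B * A)"
proof -
  have "mtrace (A * B) = (\<Sum>i<n. \<Sum>k<m. A $$ (i, k) * B $$ (k, i))"
    using assms by (auto simp: mtrace_def scalar_prod_def atLeast0LessThan)
  also have "\<dots> = (\<Sum>k<m. \<Sum>i<n. B $$ (k, i) * A $$ (i, k))"
    by (subst sum.swap) (simp add: mult.commute)
  also have "\<dots> = mtrace (B * A)"
    using assms by (auto simp: mtrace_def scalar_prod_def atLeast0LessThan)
  finally show ?thesis .
qed

text \<open>Each index \<open>a\<close> lies in \<open>(n - 1) choose (d - 1)\<close> of the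
  \<open>d\<close>-sets.\<close>

lemma mtrace_ext_der_mat:
  assumes "1 \<le> d"
  shows "mtrace (ext_der_mat n d X) = of_nat ((n - 1) choose (d - 1)) * (\<Sum>a<n. X a a)"
proof -
  have "mtrace (ext_der_mat n d X) =
     (\<Sum>i<ext_pow_dim n d. ext_der n X (single (wedge_set n d i)) (wedge_set n d i))"
    by (simp add: mtrace_def) (simp add: ext_der_mat_def)
  also have "\<dots> = (\<Sum>I\<in>wedge_sets n d. ext_der n X (single I) I)"
    by (rule sum.reindex_bij_betw[OF wedge_set_bij_betw])
  also have "\<dots> = (\<Sum>I\<in>wedge_sets n d. \<Sum>a<n. if a \<in> I then X a a else 0)"
    by (rule sum.cong[OF refl])
      (auto simp: wedge_sets_def ext_der_diag Int_absorb1 simp flip: sum.inter_restrict)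
  also have "\<dots> = (\<Sum>a<n. \<Sum>I\<in>wedge_sets n d. if a \<in> I then X a a else 0)"
    by (rule sum.swap)
  also have "\<dots> = (\<Sum>a<n. of_nat ((n - 1) choose (d - 1)) * X a a)"
  proof (rule sum.cong[OF refl])
    fix a assume "a \<in> {..<n}"
    then have a: "a < n" by simp
    have "bij_betw (insert a) {K. K \<subseteq> {..<n} - {a} \<and> card K = d - 1} {I \<in> wedge_sets n d. a \<in> I}"
    proof (rule bij_betw_byWitness[where f' = "\<lambda>I. I - {a}"])
      show "insert a ` {K. K \<subseteq> {..<n} - {a} \<and> card K = d - 1} \<subseteq> {I \<in> wedge_sets n d. a \<in> I}"
      proof (clarsimp simp: wedge_sets_def a)
        fix K assume "K \<subseteq> {..<n} - {a}" "card K = d - Suc 0"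
        moreover from this have "finite K" "a \<notin> K" using finite_subset by auto
        ultimately show "K \<subseteq> {..<n} \<and> card (insert a K) = d" using assms by auto
      qed
      show "(\<lambda>I. I - {a}) ` {I \<in> wedge_sets n d. a \<in> I} \<subseteq> {K. K \<subseteq> {..<n} - {a} \<and> card K = d - 1}"
        by (auto simp: wedge_sets_def)
    qed auto
    then have "card {I \<in> wedge_sets n d. a \<in> I} = (n - 1) choose (d - 1)"
      using n_subsets[of "{..<n} - {a}" "d - 1"] a by (simp flip: bij_betw_same_card)
    then show "(\<Sum>I\<in>wedge_sets n d. if a \<in> I then X a a else 0) = of_nat ((n - 1) choose (d - 1)) * X a a"
      by (simp add: finite_wedge_sets flip: sum.inter_filter)
  qed
  finally show ?thesis by (simp add: sum_distrib_left)
qed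

section \<open>Pairs of systems of reflections\<close>

lemma dot_add: "dot n f (\<lambda>x. v x + w x) = dot n f v + dot n f w"
  by (simp add: dot_def algebra_simps sum.distrib)

lemma dot_scale: "dot n f (\<lambda>x. r * v x) = r * dot n f v"
  by (simp add: dot_def sum_distrib_left algebra_simps)

section \<open>Brackets of rank one matrices and parallel vectors\<close>

lemma bracket_outer:
  "bracket n (outer u f) (outer v g) = lincomb2 (dot n f v) (outer u g) (- dot n g u) (outer v f)"
  by (intro ext)
    (simp add: bracket_def mmul_def outer_def lincomb2_def dot_def sum_distrib_left sum_distrib_right mult_ac)

lemma bracket_lincomb2_left:
  "bracket n (lincomb2 r X s Y) Z = lincomb2 r (bracket n X Z) s (bracket n Y Z)"
  by (intro ext)
    (simp add: bracket_def mmul_def lincomb2_def sum_distrib_left sum.distrib algebra_simps)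

lemma bracket_lincomb2_right:
  "bracket n Z (lincomb2 r X s Y) = lincomb2 r (bracket n Z X) s (bracket n Z Y)"
  by (intro ext)
    (simp add: bracket_def mmul_def lincomb2_def sum_distrib_left sum.distrib algebra_simps)

lemmas bracket_simps = bracket_outer bracket_lincomb2_left bracket_lincomb2_right

definition par :: "(nat \<Rightarrow> 'a::field) \<Rightarrow> (nat \<Rightarrow> 'a) \<Rightarrow> bool" where
  "par v w \<longleftrightarrow> (\<exists>p. v = (\<lambda>x. p * w x))"

text \<open>The substitute for linear independence: it isolates the coefficient of \<open>v\<close>
  in an identity of rank one matrices.\<close>

lemma outer_eq_outer_imp:
  assumes "\<And>x y. outer v g x y = outer w h x y" "\<not> par v w"
  shows "g y = 0"
proof (rule ccontr)
  assume "g y \<noteq> 0"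
  then have "v = (\<lambda>x. (h y / g y) * w x)"
    using assms(1)[of _ y] by (auto simp: outer_def field_simps fun_eq_iff)
  then show False using assms(2) unfolding par_def by blast
qed

text \<open>
  The element \<open>g(v) u f - f(u) v g + [u f, v g]\<close> of the Lie algebra detects whether \<open>u\<close> and \<open>v\<close> are parallel.
\<close>

definition par_test :: "nat \<Rightarrow> (nat \<Rightarrow> 'a::comm_ring_1) \<Rightarrow> (nat \<Rightarrow> 'a) \<Rightarrow> (nat \<Rightarrow> 'a) \<Rightarrow> (nat \<Rightarrow> 'a) \<Rightarrow> nat \<Rightarrow> nat \<Rightarrow> 'a" where
  "par_test n u f v g = lincomb2 1 (lincomb2 (dot n g v) (outer u f) (- dot n f u) (outer v g))
     1 (bracket n (outer u f) (outer v g))"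

text \<open>The test equals \<open>u (g(v) f + f(v) g) - v (f(u) g + g(u) f)\<close>, which is zero
  for \<open>u = p v\<close>. Conversely it is applied to a vector that makes the coefficient of
  \<open>u\<close> nonzero: to \<open>v\<close>, or to \<open>u\<close> if
  \<open>f(v) = 0\<close>.\<close>

lemma par_test_eq_0_iff:
  fixes u v :: "nat \<Rightarrow> 'a::field_char_0"
  assumes nz: "dot n f u \<noteq> 0" "dot n g v \<noteq> 0"
  shows "par_test n u f v g = (\<lambda>x y. 0) \<longleftrightarrow> par u v"
proof
  assume 0: "par_test n u f v g = (\<lambda>x y. 0)"
  have eq: "u x * (dot n g v * dot n f w + dot n f v * dot n g w) =
      v x * (dot n f u * dot n g w + dot n g u * dot n f w)" for x w
  proof -
    have "dot n (par_test n u f v g x) w = dot n (\<lambda>y. 0) w" by (simp add: 0)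
    moreover have "dot n (par_test n u f v g x) w =
      (\<Sum>y<n. dot n g v * u x * (f y * w y) - dot n f u * v x * (g y * w y) +
        (dot n f v * u x * (g y * w y) - dot n g u * v x * (f y * w y)))"
      unfolding dot_def[of n "par_test n u f v g x"]
      by (simp add: par_test_def lincomb2_def outer_def bracket_outer algebra_simps)
    moreover have "\<dots> = dot n g v * u x * dot n f w - dot n f u * v x * dot n g w +
        (dot n f v * u x * dot n g w - dot n g u * v x * dot n f w)"
      by (simp add: sum.distrib sum_subtractf dot_def flip: sum_distrib_left)
    ultimately show ?thesis by (simp add: dot_def algebra_simps)
  qed
  show "par u v"
  proof (cases "dot n f v = 0")
    case True
    then have "u = (\<lambda>x. (2 * dot n g u / dot n g v) * v x)"
      using eq[of _ u] nz by (auto simp: fun_eq_iff field_simps)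
    then show ?thesis unfolding par_def by blast
  next
    case False
    then have "u x * (2 * dot n g v * dot n f v) = v x * (dot n f u * dot n g v + dot n g u * dot n f v)" for x
      using eq[of x v] by (simp add: algebra_simps)
    then have "u = (\<lambda>x. ((dot n f u * dot n g v + dot n g u * dot n f v) / (2 * dot n g v * dot n f v)) * v x)"
      using nz False by (auto simp: fun_eq_iff field_simps)
    then show ?thesis unfolding par_def by blast
  qed
next
  assume "par u v"
  then obtain p where p: "u = (\<lambda>x. p * v x)" by (auto simp: par_def)
  show "par_test n u f v g = (\<lambda>x y. 0)"
    unfolding p by (intro ext) (simp add: par_test_def lincomb2_def outer_def bracket_outer dot_scale algebra_simps)
qed

lemma par_scalar_nonzero:
  assumes "dot n f u \<noteq> 0" "u = (\<lambda>x. p * v x)"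
  shows "p \<noteq> 0"
  using assms by (auto simp: dot_def)

text \<open>
  \<open>L\<close> is the graph of an isomorphism of Lie algebras of matrices; only closure under the operations
  and triviality of kernel and cokernel are needed. The assumption \<open>irr\<close> is irreducibility in the form of an
  induction principle over subspaces.
\<close>

locale reflection_pair =
  fixes n :: nat and S :: "'s set" and u f u' f' :: "'s \<Rightarrow> nat \<Rightarrow> 'a::field_char_0"
    and L :: "(nat \<Rightarrow> nat \<Rightarrow> 'a) \<Rightarrow> (nat \<Rightarrow> nat \<Rightarrow> 'a) \<Rightarrow> bool"
  assumes L_lincomb2: "L X X' \<Longrightarrow> L Y Y' \<Longrightarrow> L (lincomb2 r X s Y) (lincomb2 r X' s Y')"
    and L_bracket: "L X X' \<Longrightarrow> L Y Y' \<Longrightarrow> L (bracket n X Y) (bracket n X' Y')"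
    and L_zero: "L X X' \<Longrightarrow> X = (\<lambda>x y. 0) \<longleftrightarrow> X' = (\<lambda>x y. 0)"
    and L_supp: "L X X' \<Longrightarrow> n \<le> x \<Longrightarrow> X' x y = 0"
    and L_gen: "i \<in> S \<Longrightarrow> L (outer (u i) (f i)) (outer (u' i) (f' i))"
    and c_nz: "i \<in> S \<Longrightarrow> dot n (f i) (u i) \<noteq> 0"
    and c_eq: "i \<in> S \<Longrightarrow> dot n (f' i) (u' i) = dot n (f i) (u i)"
    and n_ge_2: "2 \<le> n"
    and u_supp: "i \<in> S \<Longrightarrow> n \<le> x \<Longrightarrow> u i x = 0"
    and irr: "\<lbrakk>\<And>v w. R v \<Longrightarrow> R w \<Longrightarrow> R (\<lambda>x. v x + w x); \<And>r v. R v \<Longrightarrow> R (\<lambda>x. r * v x);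
       \<And>k v. k \<in> S \<Longrightarrow> R v \<Longrightarrow> R (\<lambda>x. v x + dot n (f k) v * u k x);
       R v0; v0 \<noteq> (\<lambda>x. 0); \<And>x. n \<le> x \<Longrightarrow> v0 x = 0; \<And>x. n \<le> x \<Longrightarrow> v x = 0\<rbrakk> \<Longrightarrow> R v"
begin

section \<open>Transport of mixed products along \<open>L\<close>\<close>

abbreviation c :: "'s \<Rightarrow> 's \<Rightarrow> 'a" where "c i j \<equiv> dot n (f i) (u j)"
abbreviation c' :: "'s \<Rightarrow> 's \<Rightarrow> 'a" where "c' i j \<equiv> dot n (f' i) (u' j)"

text \<open>The splitting of a rank one matrix into vector and covector is fixed only up to a
  scalar, so a mixed product can be expected to correspond only to a multiple of its
  counterpart.\<close>

definition linked :: "'s \<Rightarrow> 's \<Rightarrow> 'a \<Rightarrow> bool" where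
  "linked i j t \<longleftrightarrow> t \<noteq> 0 \<and> L (outer (u i) (f j)) (outer (\<lambda>x. t * u' i x) (f' j))"

lemma c'_nz: "i \<in> S \<Longrightarrow> c' i i \<noteq> 0"
  using c_nz c_eq by simp

lemma u_nz: "i \<in> S \<Longrightarrow> u i \<noteq> (\<lambda>x. 0)" and f_nz: "i \<in> S \<Longrightarrow> f i \<noteq> (\<lambda>x. 0)"
  and u'_nz: "i \<in> S \<Longrightarrow> u' i \<noteq> (\<lambda>x. 0)" and f'_nz: "i \<in> S \<Longrightarrow> f' i \<noteq> (\<lambda>x. 0)"
  using c_nz[of i] c'_nz[of i] by (auto simp: dot_def)

lemma L_add_outer:
  assumes "L (outer v g) (outer v' g')" "L (outer w g) (outer w' g')"
  shows "L (outer (\<lambda>x. v x + w x) g) (outer (\<lambda>x. v' x + w' x) g')"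
proof -
  have "outer (\<lambda>x. v x + w x) g = lincomb2 1 (outer v g) 1 (outer w g)" for v w g :: "nat \<Rightarrow> 'a"
    by (intro ext) (simp add: outer_def lincomb2_def algebra_simps)
  then show ?thesis using L_lincomb2[OF assms] by simp
qed

lemma L_scale:
  assumes "L X X'"
  shows "L (\<lambda>x y. r * X x y) (\<lambda>x y. r * X' x y)"
proof -
  have "(\<lambda>x y. r * X x y) = lincomb2 r X 0 X" for X :: "nat \<Rightarrow> nat \<Rightarrow> 'a"
    by (intro ext) (simp add: lincomb2_def)
  then show ?thesis using L_lincomb2[OF assms assms, of r 0] by simp
qed

lemma L_scale_outer:
  assumes "L (outer v g) (outer v' g')"
  shows "L (outer (\<lambda>x. r * v x) g) (outer (\<lambda>x. r * v' x) g')"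
  using L_scale[OF assms, of r] by (simp add: outer_def[abs_def] mult.assoc)

lemma L_eq_left:
  assumes "L X X'" "L X X''"
  shows "X' = X''"
proof -
  have "lincomb2 1 X (-1) X = (\<lambda>x y. 0)" by (intro ext) (simp add: lincomb2_def)
  then have "lincomb2 1 X' (-1) X'' = (\<lambda>x y. 0)" using L_lincomb2[OF assms] L_zero by blast
  then show ?thesis by (auto simp: fun_eq_iff lincomb2_def)
qed

text \<open>The device that transports scalars: when a Lie expression is a multiple of
  \<open>X\<close> and its counterpart a multiple of \<open>X'\<close>, the factors agree.\<close>

lemma L_scale_cancel:
  assumes "L X X'" "L (\<lambda>x y. r * X x y) (\<lambda>x y. s * X' x y)" "X \<noteq> (\<lambda>x y. 0)"
  shows "r = s"
proof -
  have "(\<lambda>x y. r * X' x y) = (\<lambda>x y. s * X' x y)"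
    using L_eq_left[OF L_scale[OF assms(1)] assms(2)] .
  moreover have "X' \<noteq> (\<lambda>x y. 0)" using L_zero assms by blast
  ultimately show ?thesis by (auto simp: fun_eq_iff)
qed

lemma L_par_test:
  assumes "i \<in> S" "j \<in> S"
  shows "L (par_test n (u i) (f i) (u j) (f j)) (par_test n (u' i) (f' i) (u' j) (f' j))"
  unfolding par_test_def using assms by (auto simp: c_eq intro!: L_lincomb2 L_bracket L_gen)

lemma par_iff: "i \<in> S \<Longrightarrow> j \<in> S \<Longrightarrow> par (u i) (u j) \<longleftrightarrow> par (u' i) (u' j)"
  using L_zero[OF L_par_test] c_nz c'_nz by (simp add: par_test_eq_0_iff)

lemma linked_par:
  assumes "i \<in> S" "j \<in> S" "par (u i) (u j)" "linked j k t"
  shows "\<exists>s. linked i k s"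
proof -
  obtain p where p: "u i = (\<lambda>x. p * u j x)" using assms by (auto simp: par_def)
  obtain p' where p': "u' i = (\<lambda>x. p' * u' j x)" using assms par_iff by (auto simp: par_def)
  have nz: "p \<noteq> 0" "p' \<noteq> 0"
    using par_scalar_nonzero[OF c_nz p] par_scalar_nonzero[OF c'_nz p'] assms by auto
  have "L (outer (\<lambda>x. p * u j x) (f k)) (outer (\<lambda>x. p * (t * u' j x)) (f' k))"
    using assms by (intro L_scale_outer) (simp add: linked_def)
  moreover have "(\<lambda>x. p * (t * u' j x)) = (\<lambda>x. (p * t / p') * u' i x)"
    using nz by (simp add: p')
  ultimately have "linked i k (p * t / p')"
    using nz assms by (auto simp: linked_def p)
  then show ?thesis ..
qed

lemma linked_refl: "i \<in> S \<Longrightarrow> linked i i 1"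
  using L_gen by (simp add: linked_def)

lemma linked_step:
  assumes "i \<in> S" "j \<in> S" "c i j \<noteq> 0"
  shows "\<exists>t. linked i j t"
proof (cases "par (u i) (u j)")
  case True
  then show ?thesis using linked_par linked_refl assms by blast
next
  case False
  \<comment> \<open>With \<open>Z = [X_i, Y]\<close> and \<open>Y = [X_i, X_j]\<close>, the identity \<open>[Z, X_j] = (c_ii c_jj - 2 c_ij c_ji) Y\<close> shows
    that \<open>L\<close> preserves \<open>c_ij c_ji\<close>; a combination of \<open>Z\<close>, \<open>Y\<close> and \<open>X_i\<close> is a multiple of \<open>u_i f_j\<close>.\<close>
  define Y where "Y u f v g = bracket n (outer u f) (outer v g)" for u f v g :: "nat \<Rightarrow> 'a"
  define Z where "Z u f v g = bracket n (outer u f) (Y u f v g)" for u f v g :: "nat \<Rightarrow> 'a"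
  have LY: "L (Y (u i) (f i) (u j) (f j)) (Y (u' i) (f' i) (u' j) (f' j))"
    unfolding Y_def using assms by (intro L_bracket L_gen)
  have LZ: "L (Z (u i) (f i) (u j) (f j)) (Z (u' i) (f' i) (u' j) (f' j))"
    unfolding Z_def using assms by (intro L_bracket L_gen LY)
  have ZX: "bracket n (Z u f v g) (outer v g) =
      (\<lambda>x y. (dot n f u * dot n g v - 2 * dot n f v * dot n g u) * Y u f v g x y)" for u f v g :: "nat \<Rightarrow> 'a"
    by (intro ext) (simp add: Z_def Y_def bracket_simps lincomb2_def outer_def algebra_simps)
  have "L (\<lambda>x y. (c i i * c j j - 2 * c i j * c j i) * Y (u i) (f i) (u j) (f j) x y)
      (\<lambda>x y. (c i i * c j j - 2 * c' i j * c' j i) * Y (u' i) (f' i) (u' j) (f' j) x y)"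
    using L_bracket[OF LZ L_gen[OF assms(2)]] unfolding ZX using assms by (simp add: c_eq)
  \<comment> \<open>Both \<open>c i j \<noteq> 0\<close> and the absence of parallelism enter:
    \<open>Y = 0\<close> would equate \<open>u i (c i j f j)\<close> with
    \<open>u j (c j i f i)\<close>.\<close>
  moreover have "Y (u i) (f i) (u j) (f j) \<noteq> (\<lambda>x y. 0)"
  proof
    assume "Y (u i) (f i) (u j) (f j) = (\<lambda>x y. 0)"
    then have "outer (u i) (\<lambda>y. c i j * f j y) x y = outer (u j) (\<lambda>y. c j i * f i y) x y" for x y
      by (simp add: Y_def bracket_outer lincomb2_def outer_def fun_eq_iff algebra_simps)
    from outer_eq_outer_imp[OF this False] have "f j = (\<lambda>y. 0)"
      using assms by (auto simp: fun_eq_iff)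
    then show False using f_nz assms by blast
  qed
  ultimately have "c i i * c j j - 2 * c i j * c j i = c i i * c j j - 2 * c' i j * c' j i"
    using L_scale_cancel[OF LY] by blast
  then have cc: "c i j * c j i = c' i j * c' j i" by simp
  \<comment> \<open>In \<open>Z + c_ii Y\<close> the \<open>u_j f_i\<close> parts cancel, and the
    last summand removes the multiple of \<open>X_i\<close>. Its coefficient is the one whose
    preservation needed \<open>cc\<close>.\<close>
  have E: "lincomb2 1 (lincomb2 1 (Z u f v g) (dot n f u) (Y u f v g)) (2 * (dot n f v * dot n g u)) (outer u f)
     = (\<lambda>x y. (2 * dot n f u * dot n f v) * outer u g x y)" for u f v g :: "nat \<Rightarrow> 'a"
    by (intro ext) (simp add: Z_def Y_def bracket_simps lincomb2_def outer_def algebra_simps)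
  have "L (lincomb2 1 (lincomb2 1 (Z (u i) (f i) (u j) (f j)) (c i i) (Y (u i) (f i) (u j) (f j)))
        (2 * (c i j * c j i)) (outer (u i) (f i)))
     (lincomb2 1 (lincomb2 1 (Z (u' i) (f' i) (u' j) (f' j)) (c' i i) (Y (u' i) (f' i) (u' j) (f' j)))
        (2 * (c' i j * c' j i)) (outer (u' i) (f' i)))"
    unfolding cc c_eq[OF assms(1)] using assms by (intro L_lincomb2 LZ LY L_gen)
  then have *: "L (\<lambda>x y. (2 * c i i * c i j) * outer (u i) (f j) x y)
      (\<lambda>x y. (2 * c i i * c' i j) * outer (u' i) (f' j) x y)"
    unfolding E using assms by (simp add: c_eq)
  have c: "2 * c i i * c i j \<noteq> 0" using assms c_nz by simp
  define t where "t = c' i j / c i j"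
  have "L (outer (u i) (f j)) (outer (\<lambda>x. t * u' i x) (f' j))"
    using L_scale[OF *, of "1 / (2 * c i i * c i j)"] c
    by (simp add: t_def outer_def[abs_def] field_simps)
  \<comment> \<open>Nothing before excludes \<open>c' i j = 0\<close>; it is excluded because only
    zero corresponds to zero under \<open>L\<close>.\<close>
  moreover have "t \<noteq> 0"
  proof
    assume "t = 0"
    then have "outer (\<lambda>x. t * u' i x) (f' j) = (\<lambda>x y. 0)"
      by (simp add: outer_def[abs_def])
    with calculation have "outer (u i) (f j) = (\<lambda>x y. 0)" using L_zero by blast
    then show False using u_nz[OF assms(1)] f_nz[OF assms(2)] by (auto simp: outer_def fun_eq_iff)
  qed
  ultimately show ?thesis unfolding linked_def by blast
qed

lemma linked_trans:
  assumes S: "i \<in> S" "j \<in> S" "k \<in> S" and ab: "linked i j a" "linked j k b"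
  shows "\<exists>t. linked i k t"
proof (cases "par (u i) (u j)")
  case True
  then show ?thesis using linked_par assms by blast
next
  case False
  \<comment> \<open>\<open>G = c_jj u_i f_k - c_ki X_j\<close>, so it remains to see that \<open>c_ki\<close> is transported correctly. It is
    because \<open>[G, X_i] + c_ii G\<close> is \<open>c_ki\<close> times the parallelism test of \<open>i\<close> and \<open>j\<close>.\<close>
  define G where "G u g v h = bracket n (outer u g) (outer v h)" for u g v h :: "nat \<Rightarrow> 'a"
  have LG: "L (G (u i) (f j) (u j) (f k)) (G (\<lambda>x. a * u' i x) (f' j) (\<lambda>x. b * u' j x) (f' k))"
    unfolding G_def using ab by (intro L_bracket) (auto simp: linked_def)
  have G1: "lincomb2 1 (bracket n (G (\<lambda>x. a * u x) g (\<lambda>x. b * v x) h) (outer u f)) (dot n f u)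
        (G (\<lambda>x. a * u x) g (\<lambda>x. b * v x) h) =
      (\<lambda>x y. (a * b * dot n h u) * par_test n u f v g x y)"
    for a b and u f v g h :: "nat \<Rightarrow> 'a"
    by (intro ext) (simp add: G_def par_test_def bracket_simps lincomb2_def outer_def dot_scale algebra_simps)
  have "L (lincomb2 1 (bracket n (G (u i) (f j) (u j) (f k)) (outer (u i) (f i))) (c i i) (G (u i) (f j) (u j) (f k)))
     (lincomb2 1 (bracket n (G (\<lambda>x. a * u' i x) (f' j) (\<lambda>x. b * u' j x) (f' k)) (outer (u' i) (f' i))) (c' i i)
       (G (\<lambda>x. a * u' i x) (f' j) (\<lambda>x. b * u' j x) (f' k)))"
    unfolding c_eq[OF S(1)] using S by (intro L_lincomb2 L_bracket LG L_gen)
  then have "L (\<lambda>x y. c k i * par_test n (u i) (f i) (u j) (f j) x y)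
     (\<lambda>x y. (a * b * c' k i) * par_test n (u' i) (f' i) (u' j) (f' j) x y)"
    unfolding G1 using G1[of 1 "u i" "f j" 1 "u j" "f k" "f i"] by simp
  then have eq: "c k i = a * b * c' k i"
    using L_scale_cancel[OF L_par_test[OF S(1,2)]] par_test_eq_0_iff[OF c_nz c_nz] S False by blast
  have "L (lincomb2 1 (G (u i) (f j) (u j) (f k)) (c k i) (outer (u j) (f j)))
     (lincomb2 1 (G (\<lambda>x. a * u' i x) (f' j) (\<lambda>x. b * u' j x) (f' k)) (c k i) (outer (u' j) (f' j)))"
    using S by (intro L_lincomb2 LG L_gen)
  moreover have "lincomb2 1 (G (u i) (f j) (u j) (f k)) (c k i) (outer (u j) (f j)) =
     (\<lambda>x y. c j j * outer (u i) (f k) x y)"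
    by (intro ext) (simp add: G_def bracket_simps lincomb2_def outer_def algebra_simps)
  moreover have "lincomb2 1 (G (\<lambda>x. a * u' i x) (f' j) (\<lambda>x. b * u' j x) (f' k)) (c k i) (outer (u' j) (f' j)) =
     (\<lambda>x y. c j j * outer (\<lambda>x. a * b * u' i x) (f' k) x y)"
    unfolding eq using S by (intro ext) (simp add: G_def bracket_simps lincomb2_def outer_def dot_scale c_eq algebra_simps)
  ultimately have "L (\<lambda>x y. c j j * outer (u i) (f k) x y) (\<lambda>x y. c j j * outer (\<lambda>x. a * b * u' i x) (f' k) x y)"
    by simp
  from L_scale[OF this, of "1 / c j j"] have "linked i k (a * b)"
    using c_nz[OF S(2)] ab by (simp add: linked_def)
  then show ?thesis ..
qed

text \<open>For \<open>k\<close> outside the set \<open>I\<close> of generators linked to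
  \<open>j\<close>, \<open>linked_step\<close> and \<open>linked_trans\<close> force
  \<open>f k\<close> to kill every \<open>u l\<close> with \<open>l\<close> in \<open>I\<close>. The
  span of these vectors is thus invariant, hence everything, and if \<open>i\<close> were outside
  \<open>I\<close> then \<open>f i\<close> would kill \<open>u i\<close>.\<close>

lemma linked_all:
  assumes "i \<in> S" "j \<in> S"
  shows "\<exists>t. linked i j t"
proof -
  define I where "I = {k\<in>S. \<exists>t. linked k j t}"
  have j: "j \<in> I" using linked_refl assms by (auto simp: I_def)
  have closed: "k \<in> I" if "k \<in> S" "l \<in> I" "c k l \<noteq> 0" for k l
    using that linked_step[of k l] linked_trans[of k l j] assms by (auto simp: I_def)
  \<comment> \<open>The double annihilator of \<open>{u_k | k \<in> I}\<close> stands in for its span.\<close>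
  define R where "R v \<longleftrightarrow> (\<forall>g. (\<forall>k\<in>I. dot n g (u k) = 0) \<longrightarrow> dot n g v = 0)" for v
  have R: "R v" if "\<And>x. n \<le> x \<Longrightarrow> v x = 0" for v
  proof (rule irr[of R "u j"])
    fix k v assume k: "k \<in> S" and v: "R v"
    show "R (\<lambda>x. v x + dot n (f k) v * u k x)"
    proof (cases "k \<in> I")
      case True
      then show ?thesis using v by (simp add: R_def dot_add dot_scale)
    next
      case False
      then have "\<forall>l\<in>I. dot n (f k) (u l) = 0" using closed k by blast
      then have "dot n (f k) v = 0" using v by (simp add: R_def)
      then show ?thesis using v by simp
    qed
  qed (use that j u_supp u_nz assms in \<open>auto simp: R_def dot_add dot_scale\<close>)
  have "i \<in> I"
  proof (rule ccontr)
    assume "i \<notin> I"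
    then have "\<forall>l\<in>I. dot n (f i) (u l) = 0" using closed assms by blast
    then have "dot n (f i) (u i) = 0" using R[of "u i"] u_supp assms by (auto simp: R_def)
    then show False using c_nz assms by blast
  qed
  then show ?thesis by (auto simp: I_def)
qed

text \<open>If every \<open>u i\<close> lay on the line of \<open>v\<close>, that line would be
  invariant and so the whole space; but for \<open>n \<ge> 2\<close> it cannot contain two distinct
  basis vectors.\<close>

lemma not_all_par: "\<exists>i\<in>S. \<not> par (u i) v" if "\<And>x. n \<le> x \<Longrightarrow> v x = 0" "v \<noteq> (\<lambda>x. 0)"
proof (rule ccontr)
  assume "\<not> ?thesis"
  then have par: "par (u k) v" if "k \<in> S" for k using that by blast
  have all: "par w v" if "\<And>x. n \<le> x \<Longrightarrow> w x = 0" for w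
  proof (rule irr[of "\<lambda>w. par w v" v])
    fix w w' assume "par w v" "par w' v"
    then obtain p q where "w = (\<lambda>x. p * v x)" "w' = (\<lambda>x. q * v x)" by (auto simp: par_def)
    then show "par (\<lambda>x. w x + w' x) v" unfolding par_def by (intro exI[of _ "p + q"]) (simp add: algebra_simps)
  next
    fix r w assume "par w v"
    then obtain p where "w = (\<lambda>x. p * v x)" by (auto simp: par_def)
    then show "par (\<lambda>x. r * w x) v" unfolding par_def by (intro exI[of _ "r * p"]) (simp add: algebra_simps)
  next
    fix k w assume "k \<in> S" "par w v"
    then obtain p q where "w = (\<lambda>x. p * v x)" "u k = (\<lambda>x. q * v x)" using par by (force simp: par_def)
    then show "par (\<lambda>x. w x + dot n (f k) w * u k x) v" unfolding par_def
      by (intro exI[of _ "p + dot n (f k) w * q"]) (simp add: algebra_simps)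
  next
    show "par v v" unfolding par_def by (intro exI[of _ 1]) simp
  qed (use \<open>\<And>x. n \<le> x \<Longrightarrow> v x = 0\<close> \<open>v \<noteq> (\<lambda>x. 0)\<close> that in auto)
  have "par (\<lambda>x. if x = 0 then 1 else 0) v" "par (\<lambda>x. if x = 1 then 1 else 0) v"
    using n_ge_2 by (auto intro!: all)
  then obtain p q where "(\<lambda>x. if x = 0 then 1 else 0) = (\<lambda>x. p * v x)" "(\<lambda>x. if x = 1 then 1 else 0) = (\<lambda>x. q * v x)"
    by (auto simp: par_def)
  then have "p * v 0 = 1" "p * v 1 = 0" "q * v 0 = 0" "q * v 1 = 1"
    by (metis zero_neq_one)+
  then show False by auto
qed

lemma S_nonempty: "S \<noteq> {}"
proof -
  have "(\<lambda>x. if x = 0 then 1 else 0 :: 'a) \<noteq> (\<lambda>x. 0)" by (metis zero_neq_one)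
  then show ?thesis using not_all_par[of "\<lambda>x. if x = 0 then 1 else 0"] n_ge_2 by auto
qed

text \<open>The bracket of \<open>u a (f k)\<close> and \<open>u i (f j)\<close> is transported in
  two ways: as the bracket of the images, and after expansion into multiples of
  \<open>u a (f j)\<close> and \<open>u i (f k)\<close>. Since \<open>u' a\<close> and
  \<open>u' i\<close> are not parallel, the coefficients of \<open>u' a (f' j)\<close> can be
  compared.\<close>

lemma linked_outer_eq:
  assumes S: "a \<in> S" "k \<in> S" "i \<in> S" "j \<in> S" and npar: "\<not> par (u a) (u i)"
    and t: "linked a k r" "linked i j s" "linked a j t"
  shows "c k i * t = r * s * c' k i"
proof -
  obtain z where z: "linked i k z" using linked_all S by blast
  have "L (bracket n (outer (u a) (f k)) (outer (u i) (f j)))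
     (bracket n (outer (\<lambda>x. r * u' a x) (f' k)) (outer (\<lambda>x. s * u' i x) (f' j)))"
    using t by (intro L_bracket) (auto simp: linked_def)
  moreover have "L (bracket n (outer (u a) (f k)) (outer (u i) (f j)))
     (lincomb2 (c k i) (outer (\<lambda>x. t * u' a x) (f' j)) (- c j a) (outer (\<lambda>x. z * u' i x) (f' k)))"
    unfolding bracket_outer using t z by (intro L_lincomb2) (auto simp: linked_def)
  ultimately have eq: "bracket n (outer (\<lambda>x. r * u' a x) (f' k)) (outer (\<lambda>x. s * u' i x) (f' j)) =
     lincomb2 (c k i) (outer (\<lambda>x. t * u' a x) (f' j)) (- c j a) (outer (\<lambda>x. z * u' i x) (f' k))"
    by (rule L_eq_left)
  have "outer (u' a) (\<lambda>y. (c k i * t - r * s * c' k i) * f' j y) x y =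
     outer (u' i) (\<lambda>y. (c j a * z - r * s * c' j a) * f' k y) x y" for x y
    using fun_cong[OF fun_cong[OF eq, of x], of y]
    by (simp add: bracket_outer lincomb2_def outer_def dot_scale algebra_simps)
  from outer_eq_outer_imp[OF this] have "(c k i * t - r * s * c' k i) * f' j y = 0" for y
    using npar par_iff S by blast
  moreover obtain y where "f' j y \<noteq> 0" using f'_nz S by (auto simp: fun_eq_iff)
  ultimately show ?thesis by (metis eq_iff_diff_eq_0 mult_eq_0_iff)
qed

text \<open>The cocycle law. If \<open>u a\<close> and \<open>u i\<close> are not parallel it is
  \<open>linked_outer_eq\<close> at \<open>k = i\<close>, where \<open>c i i = c' i i\<close>
  cancels.\<close>

lemma linked_mult:
  assumes S: "a \<in> S" "i \<in> S" "j \<in> S" and t: "linked a i r" "linked i j s" "linked a j t"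
  shows "t = r * s"
proof (cases "par (u a) (u i)")
  case True
  then obtain p where p: "u a = (\<lambda>x. p * u i x)" by (auto simp: par_def)
  obtain p' where p': "u' a = (\<lambda>x. p' * u' i x)" using True S par_iff by (auto simp: par_def)
  have nz: "p' \<noteq> 0"
    using par_scalar_nonzero[OF c'_nz p'] S by auto
  \<comment> \<open>The scalars of \<open>a\<close> and \<open>i\<close> are in the ratio
    \<open>p / p'\<close> towards every third index \<open>m\<close>; the choices
    \<open>m = j\<close> and \<open>m = i\<close> are then compared.\<close>
  have scale: "q * p' = p * s'" if "linked a m q" "linked i m s'" "m \<in> S" for m q s'
  proof -
    have "L (outer (u a) (f m)) (outer (\<lambda>x. p * (s' * u' i x)) (f' m))"
      using that unfolding p linked_def by (intro L_scale_outer) simp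
    then have "outer (\<lambda>x. q * (p' * u' i x)) (f' m) = outer (\<lambda>x. p * (s' * u' i x)) (f' m)"
      using that L_eq_left unfolding linked_def p' by blast
    moreover obtain x where "u' i x \<noteq> 0" using u'_nz S by (auto simp: fun_eq_iff)
    moreover obtain y where "f' m y \<noteq> 0" using f'_nz \<open>m \<in> S\<close> by (auto simp: fun_eq_iff)
    ultimately show ?thesis by (force simp: outer_def fun_eq_iff)
  qed
  have "t * p' = p * s" "r * p' = p * 1"
    using scale t S linked_refl by blast+
  then have "t * p' = (r * s) * p'" by (simp add: algebra_simps)
  then show ?thesis using nz by simp
next
  case False
  then show ?thesis using linked_outer_eq[OF S(1,2,2,3) False t] c_nz[of i] c_eq[of i] S by simp
qed

text \<open>If \<open>u k\<close> and \<open>u i\<close> are not parallel, this is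
  \<open>linked_outer_eq\<close> with \<open>a = k\<close>. An auxiliary generator \<open>a\<close>
  not parallel to \<open>u i\<close> covers the parallel case as well, and its scalar
  \<open>r\<close> cancels.\<close>

lemma linked_coeff:
  assumes S: "k \<in> S" "i \<in> S" "j \<in> S" and t: "linked k j s" "linked i j t"
  shows "c k i * s = t * c' k i"
proof -
  obtain a where a: "a \<in> S" "\<not> par (u a) (u i)"
    using not_all_par[of "u i"] u_supp u_nz S by blast
  obtain r where r: "linked a k r" using linked_all a S by blast
  obtain z where z: "linked a j z" using linked_all a S by blast
  have "c k i * z = r * t * c' k i"
    using linked_outer_eq[OF a(1) S(1,2,3) a(2) r t(2) z] .
  moreover have "z = r * s" using linked_mult[OF a(1) S(1,3) r t(1) z] .
  ultimately show ?thesis using r by (auto simp: linked_def)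
qed

lemma intertwiner:
  "\<exists>q. (\<forall>v. (\<forall>x\<ge>n. v x = 0) \<longrightarrow> (\<forall>x\<ge>n. q v x = 0)) \<and>
     (\<forall>v w r s. (\<forall>x\<ge>n. v x = 0) \<longrightarrow> (\<forall>x\<ge>n. w x = 0) \<longrightarrow>
       q (\<lambda>x. r * v x + s * w x) = (\<lambda>x. r * q v x + s * q w x)) \<and>
     (\<forall>v. (\<forall>x\<ge>n. v x = 0) \<longrightarrow> q v = (\<lambda>x. 0) \<longrightarrow> v = (\<lambda>x. 0)) \<and>
     (\<forall>k\<in>S. \<forall>v. (\<forall>x\<ge>n. v x = 0) \<longrightarrow>
       q (\<lambda>x. v x + dot n (f k) v * u k x) = (\<lambda>x. q v x + dot n (f' k) (q v) * u' k x))"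
proof -
  obtain j where j: "j \<in> S" using S_nonempty by blast
  define t where "t i = (SOME s. linked i j s)" for i
  have t: "linked i j (t i)" if "i \<in> S" for i
    unfolding t_def using linked_all[OF that j] by (rule someI_ex)
  \<comment> \<open>The second conjunct makes \<open>q\<close> commute with the reflections; it is linear in \<open>v\<close> and \<open>v'\<close>, so it suffices to
    check it on the \<open>u_i\<close>.\<close>
  define rel where "rel v v' \<longleftrightarrow> L (outer v (f j)) (outer v' (f' j)) \<and>
     (\<forall>k\<in>S. dot n (f k) v * t k = dot n (f' k) v')" for v v'
  have rel_add: "rel (\<lambda>x. v x + w x) (\<lambda>x. v' x + w' x)" if "rel v v'" "rel w w'" for v v' w w'
    using that by (auto simp: rel_def dot_add algebra_simps intro: L_add_outer)
  have rel_scale: "rel (\<lambda>x. r * v x) (\<lambda>x. r * v' x)" if "rel v v'" for r v v'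
    using that by (auto simp: rel_def dot_scale algebra_simps intro: L_scale_outer)
  have rel_u: "rel (u i) (\<lambda>x. t i * u' i x)" if "i \<in> S" for i
    using t[OF that] linked_coeff[OF _ that j t t[OF that]]
    by (auto simp: rel_def linked_def dot_scale that)
  \<comment> \<open>The domain of \<open>rel\<close> is a subspace containing every
    \<open>u k\<close>, so it is stable under the reflections.\<close>
  have total: "\<exists>v'. rel v v'" if "\<forall>x\<ge>n. v x = 0" for v
    by (rule irr[of "\<lambda>v. \<exists>v'. rel v v'" "u j"])
      (use that rel_add rel_scale rel_u u_nz u_supp j in \<open>blast+\<close>)
  define q where "q v = (SOME v'. rel v v')" for v
  have q: "rel v (q v)" if "\<forall>x\<ge>n. v x = 0" for v
    unfolding q_def using total[OF that] by (rule someI_ex)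
  obtain y where y: "f' j y \<noteq> 0" using f'_nz j by (auto simp: fun_eq_iff)
  have uniq: "v' = v''" if "rel v v'" "rel v v''" for v v' v''
  proof -
    have "outer v' (f' j) = outer v'' (f' j)" using that L_eq_left by (auto simp: rel_def)
    then show ?thesis using y by (auto simp: outer_def fun_eq_iff)
  qed
  have supp: "q v x = 0" if "\<forall>x\<ge>n. v x = 0" "n \<le> x" for v x
    using L_supp[of _ "outer (q v) (f' j)" x y] q[OF that(1)] that(2) y by (auto simp: rel_def outer_def)
  have lin: "q (\<lambda>x. r * v x + s * w x) = (\<lambda>x. r * q v x + s * q w x)"
    if "\<forall>x\<ge>n. v x = 0" "\<forall>x\<ge>n. w x = 0" for v w r s
  proof (rule uniq)
    show "rel (\<lambda>x. r * v x + s * w x) (q (\<lambda>x. r * v x + s * w x))" using that by (intro q) auto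
    show "rel (\<lambda>x. r * v x + s * w x) (\<lambda>x. r * q v x + s * q w x)"
      using that by (intro rel_add rel_scale q)
  qed
  have inj: "v = (\<lambda>x. 0)" if "\<forall>x\<ge>n. v x = 0" "q v = (\<lambda>x. 0)" for v
  proof -
    have "outer (q v) (f' j) = (\<lambda>x y. 0)" by (simp add: that outer_def[abs_def])
    then have "outer v (f j) = (\<lambda>x y. 0)" using q[OF that(1)] L_zero by (auto simp: rel_def)
    moreover obtain y where "f j y \<noteq> 0" using f_nz j by (auto simp: fun_eq_iff)
    ultimately show ?thesis by (auto simp: outer_def fun_eq_iff)
  qed
  have "q (\<lambda>x. v x + dot n (f k) v * u k x) = (\<lambda>x. q v x + dot n (f' k) (q v) * u' k x)"
    if "k \<in> S" "\<forall>x\<ge>n. v x = 0" for k v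
  proof (rule uniq)
    show "rel (\<lambda>x. v x + dot n (f k) v * u k x) (q (\<lambda>x. v x + dot n (f k) v * u k x))"
      using that u_supp by (intro q) auto
    have "rel (\<lambda>x. v x + dot n (f k) v * u k x) (\<lambda>x. q v x + dot n (f k) v * (t k * u' k x))"
      using that by (intro rel_add rel_scale q rel_u)
    moreover have "dot n (f k) v * t k = dot n (f' k) (q v)"
      using q[OF that(2)] that(1) by (simp add: rel_def)
    ultimately show "rel (\<lambda>x. v x + dot n (f k) v * u k x) (\<lambda>x. q v x + dot n (f' k) (q v) * u' k x)"
      by (simp flip: mult.assoc)
  qed
  with supp lin inj show ?thesis by (intro exI[of _ q]) blast
qed

end

section \<open>Reflections and representations\<close>

lemma det_mat_2: "det (mat 2 2 g) = g (0, 0) * g (1, 1) - g (0, 1) * (g (1, 0) :: 'a::comm_ring_1)"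
  using laplace_expansion_row[of "mat 2 2 g" 2 0]
  by (simp add: numeral_2_eq_2 cofactor_def mat_delete_def det_single)

lemma pick_doubleton:
  assumes "i < k"
  shows "pick {i, k} 0 = i" "pick {i, k} (Suc 0) = k"
proof -
  have "card {a \<in> {i, k}. a < i} = 0" "card {a \<in> {i, k}. a < k} = Suc 0"
  proof -
    have "{a \<in> {i, k}. a < i} = {}" "{a \<in> {i, k}. a < k} = {i}" using assms by auto
    then show "card {a \<in> {i, k}. a < i} = 0" "card {a \<in> {i, k}. a < k} = Suc 0" by simp_all
  qed
  then show "pick {i, k} 0 = i" "pick {i, k} (Suc 0) = k"
    by (metis pick_card_in_set insertI1 insertI2)+
qed

text \<open>A nonzero 2 by 2 minor would force rank at least 2. A submatrix lists its indices
  increasingly, so ordered indices come first and the other cases follow by symmetry.\<close>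

lemma rank_1_minor:
  fixes A :: "'a::field mat"
  assumes A: "A \<in> carrier_mat n m" and r: "vec_space.rank n A = 1"
    and lt: "i < n" "k < n" "j < m" "l < m"
  shows "A $$ (i, j) * A $$ (k, l) = A $$ (i, l) * A $$ (k, j)"
proof -
  have ord: "A $$ (i, j) * A $$ (k, l) = A $$ (i, l) * A $$ (k, j)"
    if "i < k" "j < l" "k < n" "l < m" for i j k l
  proof (rule ccontr)
    assume "\<not> ?thesis"
    moreover have "submatrix A {i, k} {j, l} = mat 2 2 (\<lambda>(x, y). A $$ (pick {i, k} x, pick {j, l} y))"
      using that A by (subst submatrix_eq[of A n m]) auto
    ultimately have "det (submatrix A {i, k} {j, l}) \<noteq> 0"
      using that by (simp add: det_mat_2 pick_doubleton del: pick.simps)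
    then have "card {y. y < m \<and> y \<in> {j, l}} \<le> 1"
      using vec_space.rank_gt_minor[OF A] r by metis
    moreover have "card {y. y < m \<and> y \<in> {j, l}} = 2"
      using that by (subst card_restrict_eq) auto
    ultimately show False by simp
  qed
  consider "i = k \<or> j = l" | "i < k" "j < l" | "i < k" "l < j" | "k < i" "j < l" | "k < i" "l < j"
    by linarith
  then show ?thesis
  proof cases
    case 1
    then show ?thesis by (auto simp: mult.commute)
  next
    case 2
    then show ?thesis using ord lt by simp
  next
    case 3
    then show ?thesis using ord[of i k l j] lt by simp
  next
    case 4
    then show ?thesis using ord[of k i j l] lt by (simp add: mult.commute)
  next
    case 5
    then show ?thesis using ord[of k i l j] lt by (simp add: mult.commute)
  qed
qed

text \<open>Diagonalizability yields \<open>f(u) \<noteq> 0\<close>: otherwise \<open>A - 1\<close>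
  would square to zero, and a diagonalizable matrix with square zero is zero.\<close>

lemma reflectionE:
  fixes A :: "'a::field mat"
  assumes "is_reflection n A"
  obtains u f where "A = 1\<^sub>m n + mat n n (\<lambda>(i, j). outer u f i j)" "dot n f u \<noteq> 0"
    "\<And>x. n \<le> x \<Longrightarrow> u x = 0" "\<And>x. n \<le> x \<Longrightarrow> f x = 0"
proof -
  define B where "B = A - 1\<^sub>m n"
  have A: "A \<in> carrier_mat n n" and r: "vec_space.rank n B = 1"
    using assms by (auto simp: is_reflection_def B_def)
  have B: "B \<in> carrier_mat n n" by (simp add: B_def minus_carrier_mat)
  have "B \<noteq> 0\<^sub>m n n" using r vec_space.rank_0I[where 'a = 'a] by (metis zero_neq_one)
  then obtain k l where kl: "k < n" "l < n" "B $$ (k, l) \<noteq> 0"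
    using B by (auto simp: mat_eq_iff)
  \<comment> \<open>The row and the scaled column through a nonzero entry; vanishing of the 2 by 2
    minors says that they factor \<open>B\<close>.\<close>
  define u f where "u x = (if x < n then B $$ (x, l) / B $$ (k, l) else 0)"
    and "f x = (if x < n then B $$ (k, x) else 0)" for x
  have B_eq: "B = mat n n (\<lambda>(i, j). outer u f i j)"
    using rank_1_minor[OF B r _ kl(1) _ kl(2)] kl B
    by (intro eq_matI) (auto simp: outer_def u_def f_def field_simps)
  have "A = 1\<^sub>m n + B" using A by (intro eq_matI) (auto simp: B_def)
  moreover have "dot n f u \<noteq> 0"
  proof
    assume 0: "dot n f u = 0"
    have BB: "B * B = 0\<^sub>m n n"
    proof (intro eq_matI)
      fix i j assume "i < dim_row (0\<^sub>m n n :: 'a mat)" "j < dim_col (0\<^sub>m n n :: 'a mat)"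
      then have "(B * B) $$ (i, j) = u i * f j * dot n f u"
        by (simp add: B_eq scalar_prod_def outer_def dot_def sum_distrib_left atLeast0LessThan mult_ac)
      then show "(B * B) $$ (i, j) = 0\<^sub>m n n $$ (i, j)"
        using 0 \<open>i < _\<close> \<open>j < _\<close> by simp
    qed (use B in auto)
    obtain D P Q where D: "diagonal_mat D" and wit: "similar_mat_wit A D P Q"
      using assms by (auto simp: is_reflection_def similar_mat_def)
    have c: "D \<in> carrier_mat n n" "P \<in> carrier_mat n n" "Q \<in> carrier_mat n n"
      and PQ: "P * Q = 1\<^sub>m n" "Q * P = 1\<^sub>m n" and APDQ: "A = P * D * Q"
      using wit A by (auto simp: similar_mat_wit_def Let_def)
    define N where "N = D - 1\<^sub>m n"
    have N: "N \<in> carrier_mat n n" by (simp add: N_def minus_carrier_mat)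
    have B_conj: "B = P * N * Q"
      using c PQ by (simp add: B_def N_def APDQ mult_minus_distrib_mat[of _ n n] minus_mult_distrib_mat[of _ n n])
    have N_conj: "N = Q * B * P"
    proof -
      have "Q * B * P = Q * (P * N * Q) * P" by (simp add: B_conj)
      also have "\<dots> = (Q * P) * N * (Q * P)"
        using c N by (simp add: assoc_mult_mat[of _ n n _ n _ n])
      finally show ?thesis using PQ N by simp
    qed
    have "N * N = Q * (B * (P * Q) * B) * P"
      unfolding N_conj using c B by (simp add: assoc_mult_mat[of _ n n _ n _ n])
    also have "\<dots> = 0\<^sub>m n n" using PQ B BB c by simp
    finally have NN: "N * N = 0\<^sub>m n n" .
    have off: "N $$ (i, j) = 0" if "i < n" "j < n" "i \<noteq> j" for i j
      using D c that by (auto simp: N_def diagonal_mat_def)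
    have "N $$ (i, i) = 0" if "i < n" for i
    proof -
      have "0 = (N * N) $$ (i, i)" using NN that by simp
      also have "\<dots> = (\<Sum>k<n. N $$ (i, k) * N $$ (k, i))"
        using that N by (simp add: scalar_prod_def atLeast0LessThan)
      also have "\<dots> = (\<Sum>k<n. if k = i then N $$ (i, i) * N $$ (i, i) else 0)"
        using off that by (intro sum.cong) auto
      finally show ?thesis using that by simp
    qed
    then have "N = 0\<^sub>m n n" using off N by (intro eq_matI) (metis carrier_matD index_zero_mat, auto)
    then have "B = 0\<^sub>m n n" using B_conj c by simp
    with \<open>B \<noteq> 0\<^sub>m n n\<close> show False ..
  qed
  ultimately show thesis
    by (intro that[of u f]) (simp_all add: B_eq u_def f_def)
qed

lemma one_plus_outer_mult_vec:
  "(1\<^sub>m n + mat n n (\<lambda>(i, j). outer u f i j)) *\<^sub>v vec n v = vec n (\<lambda>x. v x + dot n f v * u x)"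
proof -
  have "(1\<^sub>m n + mat n n (\<lambda>(i, j). outer u f i j)) *\<^sub>v vec n v =
      1\<^sub>m n *\<^sub>v vec n v + mat n n (\<lambda>(i, j). outer u f i j) *\<^sub>v vec n v"
    by (rule add_mult_distrib_mat_vec) auto
  also have "\<dots> = vec n (\<lambda>x. v x + dot n f v * u x)"
    by (intro eq_vecI)
      (auto simp: scalar_prod_def outer_def dot_def sum_distrib_left sum_distrib_right atLeast0LessThan mult_ac)
  finally show ?thesis .
qed

lemma rep_mult_vec:
  assumes "is_rep W n \<rho>" "x \<in> carrier W" "y \<in> carrier W" "v \<in> carrier_vec n"
  shows "\<rho> (x \<otimes>\<^bsub>W\<^esub> y) *\<^sub>v v = \<rho> x *\<^sub>v (\<rho> y *\<^sub>v v)"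
proof -
  have "\<rho> x \<in> carrier_mat n n" "\<rho> y \<in> carrier_mat n n"
    using assms by (auto simp: is_rep_def)
  then show ?thesis
    using assms by (simp add: is_rep_def assoc_mult_mat_vec[of _ n n _ n])
qed

lemma rep_inv:
  assumes "group W" "is_rep W n \<rho>" "x \<in> carrier W"
  shows "\<rho> (inv\<^bsub>W\<^esub> x) * \<rho> x = 1\<^sub>m n" "\<rho> x * \<rho> (inv\<^bsub>W\<^esub> x) = 1\<^sub>m n"
proof -
  interpret group W by fact
  have "\<rho> (inv\<^bsub>W\<^esub> x) * \<rho> x = \<rho> (inv\<^bsub>W\<^esub> x \<otimes>\<^bsub>W\<^esub> x)" "\<rho> x * \<rho> (inv\<^bsub>W\<^esub> x) = \<rho> (x \<otimes>\<^bsub>W\<^esub> inv\<^bsub>W\<^esub> x)"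
    using assms unfolding is_rep_def by (metis inv_closed)+
  then show "\<rho> (inv\<^bsub>W\<^esub> x) * \<rho> x = 1\<^sub>m n" "\<rho> x * \<rho> (inv\<^bsub>W\<^esub> x) = 1\<^sub>m n"
    using assms by (simp_all add: is_rep_def)
qed

text \<open>Supplies the induction principle \<open>irr\<close> of the locale. The closure
  hypothesis speaks of generators only, whereas \<open>generate\<close> also contains their
  inverses; that case is the main work.\<close>

lemma irreducible_rep_subspace:
  fixes \<rho> :: "'g \<Rightarrow> 'a::field mat"
  assumes "group W" "S \<subseteq> carrier W" "generate W S = carrier W" and irr: "irreducible_rep W n \<rho>"
    and refl: "\<And>s. s \<in> S \<Longrightarrow> \<rho> s = 1\<^sub>m n + mat n n (\<lambda>(i, j). outer (u s) (f s) i j)"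
    and u_supp: "\<And>s x. s \<in> S \<Longrightarrow> n \<le> x \<Longrightarrow> u s x = 0"
    and c_nz: "\<And>s. s \<in> S \<Longrightarrow> dot n (f s) (u s) \<noteq> 0"
    and add: "\<And>v w. R v \<Longrightarrow> R w \<Longrightarrow> R (\<lambda>x. v x + w x)"
    and scale: "\<And>r v. R v \<Longrightarrow> R (\<lambda>x. r * v x)"
    and step: "\<And>s v. s \<in> S \<Longrightarrow> R v \<Longrightarrow> R (\<lambda>x. v x + dot n (f s) v * u s x)"
    and v0: "R v0" "v0 \<noteq> (\<lambda>x. 0)" "\<And>x. n \<le> x \<Longrightarrow> v0 x = 0"
    and v: "\<And>x. n \<le> x \<Longrightarrow> v x = 0"
  shows "R v"
proof -
  interpret group W by fact
  have rep: "is_rep W n \<rho>" using irr by (simp add: irreducible_rep_def)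
  define U where "U = {vec n w |w. R w \<and> (\<forall>x\<ge>n. w x = 0)}"
  have U_carrier: "U \<subseteq> carrier_vec n" by (auto simp: U_def)
  have gen_inv: "\<rho> w *\<^sub>v y \<in> U" if "w \<in> generate W S" "y \<in> U" for w y
    using that
  proof (induction w arbitrary: y rule: generate.induct)
    case one
    then show ?case using rep U_carrier by (auto simp: is_rep_def)
  next
    case (incl s)
    then obtain w where "y = vec n w" "R w" "\<forall>x\<ge>n. w x = 0" by (auto simp: U_def)
    then show ?case
      using incl step u_supp by (auto simp: U_def refl one_plus_outer_mult_vec)
  next
    case (inv s)
    then obtain w where w: "y = vec n w" "R w" "\<forall>x\<ge>n. w x = 0" by (auto simp: U_def)
    have s: "s \<in> carrier W" using inv assms by auto
    let ?c = "dot n (f s) (u s)"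
    \<comment> \<open>\<open>1 + ?c\<close> is the eigenvalue of \<open>\<rho> s\<close> on
      \<open>u s\<close>, and \<open>\<rho> s\<close> is invertible.\<close>
    have c: "1 + ?c \<noteq> 0"
    proof
      assume "1 + ?c = 0"
      then have "?c = -1" by (simp add: eq_neg_iff_add_eq_0 add.commute)
      then have "\<rho> s *\<^sub>v vec n (u s) = 0\<^sub>v n"
        using inv by (auto simp: refl one_plus_outer_mult_vec)
      moreover have "\<rho> (inv\<^bsub>W\<^esub> s) *\<^sub>v (\<rho> s *\<^sub>v vec n (u s)) = \<rho> (inv\<^bsub>W\<^esub> s \<otimes>\<^bsub>W\<^esub> s) *\<^sub>v vec n (u s)"
        using s rep by (intro rep_mult_vec[symmetric, of W n]) auto
      ultimately have "vec n (u s) = \<rho> (inv\<^bsub>W\<^esub> s) *\<^sub>v 0\<^sub>v n"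
        using s rep by (simp add: is_rep_def)
      also have "\<dots> = 0\<^sub>v n"
      proof (rule eq_vecI)
        have "\<rho> (inv\<^bsub>W\<^esub> s) \<in> carrier_mat n n" using s rep by (simp add: is_rep_def)
        then show "(\<rho> (inv\<^bsub>W\<^esub> s) *\<^sub>v 0\<^sub>v n) $ i = 0\<^sub>v n $ i" if "i < dim_vec (0\<^sub>v n :: 'a vec)" for i
          using that by auto
      qed (use s rep in \<open>auto simp: is_rep_def\<close>)
      finally have "\<And>x. x < n \<Longrightarrow> u s x = 0" by (auto simp: vec_eq_iff)
      then have "dot n (f s) (u s) = 0" by (simp add: dot_def)
      then show False using c_nz inv by blast
    qed
    \<comment> \<open>The preimage of \<open>w\<close> under the reflection: the inverse of
      \<open>1 + u f\<close> is \<open>1 - u f / (1 + f(u))\<close>.\<close>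
    define w' where "w' x = w x + (- 1 / (1 + ?c)) * (dot n (f s) w * u s x)" for x
    \<comment> \<open>\<open>f(w) u\<close> is obtained as the difference of the reflected
      \<open>w\<close> and \<open>w\<close>.\<close>
    have "R (\<lambda>x. (w x + dot n (f s) w * u s x) + (-1) * w x)"
      using w inv.hyps by (intro add scale step)
    then have "R (\<lambda>x. dot n (f s) w * u s x)" by simp
    from add[OF w(2) scale[OF this]] have "R w'" unfolding w'_def[abs_def] .
    moreover have "\<forall>x\<ge>n. w' x = 0" using w u_supp inv by (simp add: w'_def)
    ultimately have w'_U: "vec n w' \<in> U" by (auto simp: U_def)
    have "dot n (f s) w' = dot n (f s) w + (- 1 / (1 + ?c)) * (dot n (f s) w * ?c)"
      unfolding w'_def[abs_def] dot_add dot_scale ..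
    also have "\<dots> = dot n (f s) w / (1 + ?c)"
      using c by (simp add: field_simps)
    finally have "(\<lambda>x. w' x + dot n (f s) w' * u s x) = w"
      by (simp add: w'_def fun_eq_iff)
    then have "\<rho> s *\<^sub>v vec n w' = y"
      using inv w by (simp add: refl one_plus_outer_mult_vec)
    then have "\<rho> (inv\<^bsub>W\<^esub> s) *\<^sub>v y = \<rho> (inv\<^bsub>W\<^esub> s \<otimes>\<^bsub>W\<^esub> s) *\<^sub>v vec n w'"
      using s rep by (subst rep_mult_vec[of W n]) auto
    also have "\<dots> = vec n w'" using s rep by (simp add: is_rep_def)
    finally show ?case using w'_U by simp
  next
    case (eng h1 h2)
    moreover have "h1 \<in> carrier W" "h2 \<in> carrier W"
      using eng assms by auto
    ultimately show ?case
      using rep U_carrier by (subst rep_mult_vec[of W n]) auto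
  qed
  have "invariant_subspace W n \<rho> U"
    unfolding invariant_subspace_def
  proof (intro conjI ballI allI)
    show "0\<^sub>v n \<in> U"
      using scale[OF v0(1), of 0] by (auto simp: U_def intro!: exI[of _ "\<lambda>x. 0"])
    show "y + z \<in> U" if yz: "y \<in> U" "z \<in> U" for y z
    proof -
      obtain w w' where w: "y = vec n w" "R w" "\<forall>x\<ge>n. w x = 0" "z = vec n w'" "R w'" "\<forall>x\<ge>n. w' x = 0"
        using yz by (auto simp: U_def)
      have "y + z = vec n (\<lambda>x. w x + w' x)" unfolding w(1,4) by auto
      moreover have "R (\<lambda>x. w x + w' x)" "\<forall>x\<ge>n. w x + w' x = 0" using add w by auto
      ultimately show ?thesis unfolding U_def by blast
    qed
    show "r \<cdot>\<^sub>v y \<in> U" if y: "y \<in> U" for r y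
    proof -
      obtain w where w: "y = vec n w" "R w" "\<forall>x\<ge>n. w x = 0"
        using y by (auto simp: U_def)
      have "r \<cdot>\<^sub>v y = vec n (\<lambda>x. r * w x)" unfolding w(1) by auto
      moreover have "R (\<lambda>x. r * w x)" "\<forall>x\<ge>n. r * w x = 0" using scale w by auto
      ultimately show ?thesis unfolding U_def by blast
    qed
  qed (use U_carrier gen_inv assms in auto)
  then have "U = {0\<^sub>v n} \<or> U = carrier_vec n"
    using irr by (simp add: irreducible_rep_def)
  moreover have "vec n v0 \<in> U" using v0 by (auto simp: U_def)
  moreover have "vec n v0 \<noteq> 0\<^sub>v n"
  proof
    assume "vec n v0 = 0\<^sub>v n"
    then have "v0 x = 0" if "x < n" for x using that by (auto simp: vec_eq_iff)
    then show False using v0 by (metis ext linorder_not_less)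
  qed
  ultimately have "vec n v \<in> U" by auto
  then obtain w where w: "vec n v = vec n w" "R w" "\<forall>x\<ge>n. w x = 0" by (auto simp: U_def)
  then have "v x = w x" if "x < n" for x using that by (auto simp: vec_eq_iff)
  then have "v = w" using w v by (metis ext linorder_not_less)
  then show ?thesis using w by simp
qed

section \<open>Two binomial coefficients determine dimension and degree\<close>

lemma binomial_le_shift: "n choose d \<le> (n + i + j) choose (d + i)"
proof -
  have "n choose d \<le> (n + i) choose (d + i)"
    by (induction i) auto
  also have "\<dots> \<le> (n + i + j) choose (d + i)"
    by (simp add: binomial_right_mono)
  finally show ?thesis .
qed

text \<open>The quotient of the two binomials is \<open>n / d\<close>. With equal quotients,
  \<open>n1 < n2\<close> makes both \<open>d\<close> and \<open>n - d\<close> grow strictly, and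
  then \<open>n choose d\<close> grows strictly in Pascal's triangle.\<close>

lemma binomial_pair_not_less:
  assumes d: "1 \<le> d1" "d1 < n1" "1 \<le> d2" "d2 < n2"
    and eq: "n1 choose d1 = n2 choose d2" "(n1 - 1) choose (d1 - 1) = (n2 - 1) choose (d2 - 1)"
  shows "\<not> n1 < n2"
proof
  assume lt: "n1 < n2"
  have "d1 * (n1 choose d1) = n1 * ((n1 - 1) choose (d1 - 1))" "d2 * (n2 choose d2) = n2 * ((n2 - 1) choose (d2 - 1))"
    using d by (simp_all add: times_binomial_minus1_eq)
  then have "(n1 * d2) * ((n1 choose d1) * ((n1 - 1) choose (d1 - 1))) = (n2 * d1) * ((n1 choose d1) * ((n1 - 1) choose (d1 - 1)))"
    using eq by (metis mult.assoc mult.commute mult.left_commute)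
  moreover have "(n1 choose d1) * ((n1 - 1) choose (d1 - 1)) \<noteq> 0" using d by simp
  ultimately have cross: "n1 * d2 = n2 * d1" by simp
  have d_lt: "d1 < d2"
  proof (rule ccontr)
    assume "\<not> d1 < d2"
    then have "n1 * d2 \<le> n1 * d1" by simp
    also have "\<dots> < n2 * d1" using lt d by simp
    finally show False using cross by simp
  qed
  have e_lt: "n1 - d1 < n2 - d2"
  proof (rule ccontr)
    assume "\<not> ?thesis"
    then have "n1 * (n2 - d2) \<le> n1 * (n1 - d1)" by simp
    also have "\<dots> < n2 * (n1 - d1)" using lt d by simp
    finally show False using cross by (simp add: diff_mult_distrib2 mult.commute)
  qed
  \<comment> \<open>Strict because \<open>d1 < n1\<close> makes the other summand
    \<open>n1 choose Suc d1\<close> positive.\<close>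
  have "n1 choose d1 < Suc n1 choose Suc d1"
    using d by simp
  also have "\<dots> \<le> (Suc n1 + (d2 - Suc d1) + ((n2 - d2) - (n1 - d1))) choose (Suc d1 + (d2 - Suc d1))"
    by (rule binomial_le_shift)
  also have "Suc n1 + (d2 - Suc d1) + ((n2 - d2) - (n1 - d1)) = n2"
    using d_lt e_lt d by simp
  also have "Suc d1 + (d2 - Suc d1) = d2" using d_lt by simp
  finally show False using eq by simp
qed

lemma binomial_pair_inj:
  assumes d: "1 \<le> d1" "d1 < n1" "1 \<le> d2" "d2 < n2"
    and eq: "n1 choose d1 = n2 choose d2" "(n1 - 1) choose (d1 - 1) = (n2 - 1) choose (d2 - 1)"
  shows "n1 = n2 \<and> d1 = d2"
proof -
  have n: "n1 = n2"
    using binomial_pair_not_less[OF d eq] binomial_pair_not_less[OF d(3,4,1,2) eq[symmetric]] by simp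
  have "d1 * (n1 choose d1) = n1 * ((n1 - 1) choose (d1 - 1))" "d2 * (n2 choose d2) = n2 * ((n2 - 1) choose (d2 - 1))"
    using d by (simp_all add: times_binomial_minus1_eq)
  then have "d1 * (n1 choose d1) = d2 * (n1 choose d1)" using eq n by simp
  then show ?thesis using n d by simp
qed

section \<open>From generators and coordinate functions to representations and matrices\<close>

lemma reflection_repE:
  fixes \<rho> :: "'g \<Rightarrow> 'a::field mat"
  assumes "reflection_rep W S n \<rho>"
  obtains u f where "\<And>s. s \<in> S \<Longrightarrow> \<rho> s = 1\<^sub>m n + mat n n (\<lambda>(i, j). outer (u s) (f s) i j)"
    "\<And>s. s \<in> S \<Longrightarrow> dot n (f s) (u s) \<noteq> 0"
    "\<And>s x. s \<in> S \<Longrightarrow> n \<le> x \<Longrightarrow> u s x = 0" "\<And>s x. s \<in> S \<Longrightarrow> n \<le> x \<Longrightarrow> f s x = 0"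
proof -
  let ?P = "\<lambda>s u f. \<rho> s = 1\<^sub>m n + mat n n (\<lambda>(i, j). outer u f i j) \<and> dot n f u \<noteq> 0 \<and>
    (\<forall>x\<ge>n. u x = 0) \<and> (\<forall>x\<ge>n. f x = 0)"
  have "\<exists>p. ?P s (fst p) (snd p)" if "s \<in> S" for s
  proof -
    have "is_reflection n (\<rho> s)" using assms that by (simp add: reflection_rep_def)
    then obtain u f where "?P s u f" by (rule reflectionE) blast
    then show ?thesis by (intro exI[of _ "(u, f)"]) simp
  qed
  then obtain g where "\<And>s. s \<in> S \<Longrightarrow> ?P s (fst (g s)) (snd (g s))" by metis
  then show thesis by (intro that[of "\<lambda>s. fst (g s)" "\<lambda>s. snd (g s)"]) auto
qed

lemma iso_rep_of_generators:
  fixes \<rho>1 \<rho>2 :: "'g \<Rightarrow> 'a::field mat"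
  assumes "group W" "S \<subseteq> carrier W" "generate W S = carrier W"
    and rep: "is_rep W n \<rho>1" "is_rep W n \<rho>2"
    and Q: "Q \<in> carrier_mat n n" "invertible_mat Q"
    and gen: "\<And>s. s \<in> S \<Longrightarrow> Q * \<rho>1 s = \<rho>2 s * Q"
  shows "iso_rep W n \<rho>1 n \<rho>2"
proof -
  interpret group W by fact
  have c: "\<rho>1 w \<in> carrier_mat n n" "\<rho>2 w \<in> carrier_mat n n" if "w \<in> carrier W" for w
    using rep that by (auto simp: is_rep_def)
  have "Q * \<rho>1 w = \<rho>2 w * Q" if "w \<in> generate W S" for w
    using that
  proof (induction w rule: generate.induct)
    case one
    then show ?case using rep Q by (simp add: is_rep_def)
  next
    case (incl s)
    then show ?case by (rule gen)
  next
    case (inv s)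
    then have s: "s \<in> carrier W" "inv\<^bsub>W\<^esub> s \<in> carrier W" using assms by auto
    note cs = c[OF s(1)] c[OF s(2)]
    have "Q * \<rho>1 (inv\<^bsub>W\<^esub> s) = (\<rho>2 (inv\<^bsub>W\<^esub> s) * \<rho>2 s) * (Q * \<rho>1 (inv\<^bsub>W\<^esub> s))"
      using rep_inv(1)[OF assms(1) rep(2) s(1)] cs Q by simp
    also have "\<dots> = \<rho>2 (inv\<^bsub>W\<^esub> s) * ((\<rho>2 s * Q) * \<rho>1 (inv\<^bsub>W\<^esub> s))"
      using cs Q by (simp add: assoc_mult_mat[of _ n n _ n _ n])
    also have "\<dots> = \<rho>2 (inv\<^bsub>W\<^esub> s) * (Q * (\<rho>1 s * \<rho>1 (inv\<^bsub>W\<^esub> s)))"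
      using cs Q by (simp add: gen[OF inv, symmetric] assoc_mult_mat[of _ n n _ n _ n])
    also have "\<dots> = \<rho>2 (inv\<^bsub>W\<^esub> s) * Q"
      using rep_inv(2)[OF assms(1) rep(1) s(1)] Q by simp
    finally show ?case .
  next
    case (eng h1 h2)
    then have h: "h1 \<in> carrier W" "h2 \<in> carrier W" using assms by auto
    note ch = c[OF h(1)] c[OF h(2)]
    have "Q * \<rho>1 (h1 \<otimes>\<^bsub>W\<^esub> h2) = (Q * \<rho>1 h1) * \<rho>1 h2"
      using rep h ch Q by (simp add: is_rep_def assoc_mult_mat[of _ n n _ n _ n])
    also have "\<dots> = \<rho>2 h1 * (Q * \<rho>1 h2)"
      using ch Q by (simp add: eng.IH(1) assoc_mult_mat[of _ n n _ n _ n])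
    also have "\<dots> = \<rho>2 (h1 \<otimes>\<^bsub>W\<^esub> h2) * Q"
      using rep h ch Q by (simp add: eng.IH(2) is_rep_def assoc_mult_mat[of _ n n _ n _ n])
    finally show ?case .
  qed
  then show ?thesis using Q assms by (auto simp: iso_rep_def)
qed

lemma invertible_mat_of_injective:
  fixes Q :: "'a::field mat"
  assumes Q: "Q \<in> carrier_mat n n"
    and inj: "\<And>v. v \<in> carrier_vec n \<Longrightarrow> Q *\<^sub>v v = 0\<^sub>v n \<Longrightarrow> v = 0\<^sub>v n"
  shows "invertible_mat Q"
proof -
  have "det Q \<noteq> 0" using det_0_iff_vec_prod_zero_field[OF Q] inj by blast
  from det_non_zero_imp_unit[OF Q this] obtain R where "R \<in> carrier_mat n n" "R * Q = 1\<^sub>m n" "Q * R = 1\<^sub>m n"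
    by (auto simp: Units_def ring_mat_def)
  then show ?thesis using Q unfolding invertible_mat_def inverts_mat_def by auto
qed

lemma mat_eq_of_mult_vec:
  fixes A B :: "'a::field mat"
  assumes "A \<in> carrier_mat n m" "B \<in> carrier_mat n m"
    and eq: "\<And>v. (\<forall>x\<ge>m. v x = 0) \<Longrightarrow> A *\<^sub>v vec m v = B *\<^sub>v vec m v"
  shows "A = B"
proof (rule eq_matI)
  fix i j assume "i < dim_row B" "j < dim_col B"
  then have ij: "i < n" "j < m" using assms by auto
  have "(M *\<^sub>v vec m (\<lambda>x. if x = j then 1 else 0)) $ i = M $$ (i, j)"
    if M: "M \<in> carrier_mat n m" for M :: "'a mat"
  proof -
    have "(M *\<^sub>v vec m (\<lambda>x. if x = j then 1 else 0)) $ i = (\<Sum>k<m. M $$ (i, k) * (if k = j then 1 else 0))"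
      using M ij by (simp add: scalar_prod_def atLeast0LessThan)
    also have "\<dots> = (\<Sum>k<m. if k = j then M $$ (i, k) else 0)"
      by (intro sum.cong) auto
    also have "\<dots> = M $$ (i, j)" using ij by simp
    finally show ?thesis .
  qed
  moreover have "A *\<^sub>v vec m (\<lambda>x. if x = j then 1 else 0) = B *\<^sub>v vec m (\<lambda>x. if x = j then 1 else 0)"
    using ij by (intro eq) auto
  ultimately show "A $$ (i, j) = B $$ (i, j)"
    using assms(1,2) by metis
qed (use assms in auto)

lemma linear_fun_matrix:
  fixes q :: "(nat \<Rightarrow> 'a::comm_ring_1) \<Rightarrow> nat \<Rightarrow> 'a"
  assumes lin: "\<And>v w r s. \<lbrakk>\<forall>x\<ge>n. v x = 0; \<forall>x\<ge>n. w x = 0\<rbrakk> \<Longrightarrow>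
       q (\<lambda>x. r * v x + s * w x) = (\<lambda>x. r * q v x + s * q w x)"
    and v: "\<forall>x\<ge>n. v x = 0"
  shows "mat n n (\<lambda>(i, k). q (\<lambda>x. if x = k then 1 else 0) i) *\<^sub>v vec n v = vec n (q v)"
proof -
  let ?e = "\<lambda>k x. if x = k then 1 else 0 :: 'a"
  have "q (\<lambda>x. if x < m then v x else 0) = (\<lambda>x. \<Sum>k<m. v k * q (?e k) x)" if "m \<le> n" for m
    using that
  proof (induction m)
    case 0
    show ?case using lin[of "\<lambda>x. 0" "\<lambda>x. 0" 0 0] by simp
  next
    case (Suc m)
    have "(\<lambda>x. if x < Suc m then v x else 0) = (\<lambda>x. 1 * (if x < m then v x else 0) + v m * ?e m x)"
      by (auto simp: less_Suc_eq)
    then have "q (\<lambda>x. if x < Suc m then v x else 0) = q (\<lambda>x. 1 * (if x < m then v x else 0) + v m * ?e m x)"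
      by (rule arg_cong)
    also have "\<dots> = (\<lambda>x. 1 * q (\<lambda>x. if x < m then v x else 0) x + v m * q (?e m) x)"
      using Suc.prems by (intro lin) auto
    finally show ?case using Suc by simp
  qed
  from this[of n] have "q (\<lambda>x. if x < n then v x else 0) = (\<lambda>x. \<Sum>k<n. v k * q (?e k) x)" by simp
  moreover have "(\<lambda>x. if x < n then v x else 0) = v" using v by auto
  ultimately have "q v = (\<lambda>x. \<Sum>k<n. v k * q (?e k) x)" by simp
  then show ?thesis
    by (intro eq_vecI) (simp_all add: scalar_prod_def atLeast0LessThan mult.commute)
qed

text \<open>Without generators every subspace is invariant, in particular the hyperplane
  \<open>v 1 = 0\<close>, which contains the basis vector at 0 but not the one at 1. A generator is
  required for comparing traces, before the locale with its single dimension is available.\<close>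

lemma generators_nonempty:
  fixes \<rho> :: "'g \<Rightarrow> 'a::field mat"
  assumes "group W" "S \<subseteq> carrier W" "generate W S = carrier W" "irreducible_rep W n \<rho>" "2 \<le> n"
  shows "S \<noteq> {}"
proof
  assume "S = {}"
  moreover have "(\<lambda>x. if x = 0 then 1 else 0 :: 'a) \<noteq> (\<lambda>x. 0)"
    by (metis zero_neq_one)
  ultimately have "(\<lambda>x. if x = 1 then 1 else 0 :: 'a) 1 = 0"
    using irreducible_rep_subspace[OF assms(1-4), of undefined undefined "\<lambda>v. v 1 = 0" "\<lambda>x. if x = 0 then 1 else 0"
        "\<lambda>x. if x = 1 then 1 else 0"] assms(5)
    by auto
  then show False by simp
qed

lemma intertwining_one_plus:
  fixes P :: "'a::field mat"
  assumes "P \<in> carrier_mat m n" "A \<in> carrier_mat n n" "B \<in> carrier_mat m m"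
    and "P * (1\<^sub>m n + A) = (1\<^sub>m m + B) * P"
  shows "P * A = B * P"
proof -
  have "P * (1\<^sub>m n + A) = P + P * A" "(1\<^sub>m m + B) * P = P + B * P"
    using assms mult_add_distrib_mat[of P m n "1\<^sub>m n" n A] add_mult_distrib_mat[of "1\<^sub>m m" m m B P n]
    by simp_all
  then have eq: "P + P * A = P + B * P" using assms(4) by simp
  have cancel: "X = Y" if "X \<in> carrier_mat m n" "Y \<in> carrier_mat m n" "P + X = P + Y" for X Y
  proof (rule eq_matI)
    fix i j assume ij: "i < dim_row Y" "j < dim_col Y"
    have "(P + X) $$ (i, j) = (P + Y) $$ (i, j)" using that(3) by simp
    then show "X $$ (i, j) = Y $$ (i, j)" using that(1,2) ij assms(1) by auto
  qed (use that in auto)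
  show ?thesis
    by (rule cancel[OF mult_carrier_mat mult_carrier_mat eq]) (rule assms)+
qed

lemma mtrace_conj:
  fixes P :: "'a::field mat"
  assumes "P \<in> carrier_mat n n" "P' \<in> carrier_mat n n" "P' * P = 1\<^sub>m n" "P * P' = 1\<^sub>m n"
    and "A \<in> carrier_mat n n" "B \<in> carrier_mat n n" "P * A = B * P"
  shows "mtrace A = mtrace B"
proof -
  have "A = P' * (P * A)"
    using assoc_mult_mat[of P' n n P n A n] assms(1-3,5) by simp
  also have "\<dots> = P' * (B * P)" by (simp only: assms(7))
  also have "mtrace \<dots> = mtrace ((B * P) * P')"
    using assms by (intro mtrace_mult_commute[of P' n n]) auto
  also have "(B * P) * P' = B"
    using assoc_mult_mat[of B n n P n P' n] assms(1,2,4,6) by simp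
  finally show ?thesis .
qed

section \<open>The graph of the Lie algebra isomorphism\<close>

definition mat_supp :: "nat \<Rightarrow> (nat \<Rightarrow> nat \<Rightarrow> 'a::zero) \<Rightarrow> bool" where
  "mat_supp n X \<longleftrightarrow> (\<forall>x y. n \<le> x \<or> n \<le> y \<longrightarrow> X x y = 0)"

text \<open>The relation \<open>L\<close> of the locale. The support conditions make equality of
  coefficient functions the same as equality of matrices, so that faithfulness yields
  \<open>L_zero\<close>.\<close>

definition ext_intertwined :: "nat \<Rightarrow> nat \<Rightarrow> 'a::comm_ring_1 mat \<Rightarrow> (nat \<Rightarrow> nat \<Rightarrow> 'a) \<Rightarrow> (nat \<Rightarrow> nat \<Rightarrow> 'a) \<Rightarrow> bool" where
  "ext_intertwined n d P X X' \<longleftrightarrow> mat_supp n X \<and> mat_supp n X' \<and> P * ext_der_mat n d X = ext_der_mat n d X' * P"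

lemma ext_intertwined_lincomb2:
  assumes P: "P \<in> carrier_mat (ext_pow_dim n d) (ext_pow_dim n d)"
    and "ext_intertwined n d P X X'" "ext_intertwined n d P Y Y'"
  shows "ext_intertwined n d P (lincomb2 r X s Y) (lincomb2 r X' s Y')"
proof -
  let ?N = "ext_pow_dim n d"
  have "P * ext_der_mat n d (lincomb2 r X s Y) =
      r \<cdot>\<^sub>m (P * ext_der_mat n d X) + s \<cdot>\<^sub>m (P * ext_der_mat n d Y)"
    using P unfolding ext_der_mat_lincomb2
    by (subst mult_add_distrib_mat[of _ ?N ?N _ ?N]) (simp_all add: mult_smult_distrib[of _ ?N ?N _ ?N])
  also have "\<dots> = r \<cdot>\<^sub>m (ext_der_mat n d X' * P) + s \<cdot>\<^sub>m (ext_der_mat n d Y' * P)"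
    using assms by (simp add: ext_intertwined_def)
  also have "\<dots> = ext_der_mat n d (lincomb2 r X' s Y') * P"
    using P unfolding ext_der_mat_lincomb2
    by (subst add_mult_distrib_mat[of _ ?N ?N _ _ ?N]) (simp_all add: mult_smult_assoc_mat[of _ ?N ?N _ ?N])
  finally show ?thesis using assms by (auto simp: ext_intertwined_def mat_supp_def lincomb2_def)
qed

lemma ext_intertwined_bracket:
  assumes P: "P \<in> carrier_mat (ext_pow_dim n d) (ext_pow_dim n d)"
    and X: "ext_intertwined n d P X X'" and Y: "ext_intertwined n d P Y Y'"
  shows "ext_intertwined n d P (bracket n X Y) (bracket n X' Y')"
proof -
  let ?N = "ext_pow_dim n d" and ?D = "ext_der_mat n d"
  have D: "?D Z \<in> carrier_mat ?N ?N" for Z :: "nat \<Rightarrow> nat \<Rightarrow> 'a" by simp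
  have prod: "P * (?D Z * ?D V) = (?D Z' * ?D V') * P"
    if "ext_intertwined n d P Z Z'" "ext_intertwined n d P V V'" for Z Z' V V'
  proof -
    have "P * (?D Z * ?D V) = (P * ?D Z) * ?D V" by (rule assoc_mult_mat[symmetric, OF P D D])
    also have "\<dots> = (?D Z' * P) * ?D V" using that by (simp add: ext_intertwined_def)
    also have "\<dots> = ?D Z' * (P * ?D V)" by (rule assoc_mult_mat[OF D P D])
    also have "\<dots> = ?D Z' * (?D V' * P)" using that by (simp add: ext_intertwined_def)
    also have "\<dots> = (?D Z' * ?D V') * P" by (rule assoc_mult_mat[symmetric, OF D D P])
    finally show ?thesis .
  qed
  have "P * ?D (bracket n X Y) = P * (?D X * ?D Y) - P * (?D Y * ?D X)"
    unfolding ext_der_mat_bracket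
    by (rule mult_minus_distrib_mat[OF P mult_carrier_mat[OF D D] mult_carrier_mat[OF D D]])
  also have "\<dots> = (?D X' * ?D Y') * P - (?D Y' * ?D X') * P"
    unfolding prod[OF X Y] prod[OF Y X] ..
  also have "\<dots> = ?D (bracket n X' Y') * P"
    unfolding ext_der_mat_bracket
    by (rule minus_mult_distrib_mat[symmetric, OF mult_carrier_mat[OF D D] mult_carrier_mat[OF D D] P])
  finally show ?thesis
    using X Y by (auto simp: ext_intertwined_def mat_supp_def bracket_def mmul_def)
qed

lemma ext_der_mat_eq_0_iff:
  fixes X :: "nat \<Rightarrow> nat \<Rightarrow> 'a::field_char_0"
  assumes "1 \<le> d" "d < n" "mat_supp n X"
  shows "ext_der_mat n d X = 0\<^sub>m (ext_pow_dim n d) (ext_pow_dim n d) \<longleftrightarrow> X = (\<lambda>x y. 0)"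
proof
  assume 0: "ext_der_mat n d X = 0\<^sub>m (ext_pow_dim n d) (ext_pow_dim n d)"
  have "X x y = 0" for x y
  proof (cases "x < n \<and> y < n")
    case True
    then show ?thesis using ext_der_mat_eq_0_imp[OF assms(1,2) 0] by blast
  next
    case False
    then show ?thesis using assms(3) by (auto simp: mat_supp_def)
  qed
  then show "X = (\<lambda>x y. 0)" by blast
next
  assume "X = (\<lambda>x y. 0)"
  then show "ext_der_mat n d X = 0\<^sub>m (ext_pow_dim n d) (ext_pow_dim n d)"
    by (intro eq_matI) (auto simp: ext_der_mat_def ext_der_def)
qed

lemma intertwined_0_iff:
  fixes P :: "'a::field mat"
  assumes c: "P \<in> carrier_mat n n" "P' \<in> carrier_mat n n" "A \<in> carrier_mat n n" "B \<in> carrier_mat n n"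
    and inv: "P' * P = 1\<^sub>m n" "P * P' = 1\<^sub>m n" and AB: "P * A = B * P"
  shows "A = 0\<^sub>m n n \<longleftrightarrow> B = 0\<^sub>m n n"
proof
  assume "A = 0\<^sub>m n n"
  then have "B * P = 0\<^sub>m n n" using AB c(1) by simp
  then have "(B * P) * P' = 0\<^sub>m n n" using c(2) by simp
  then show "B = 0\<^sub>m n n" using assoc_mult_mat[OF c(4,1,2)] inv c(4) by simp
next
  assume "B = 0\<^sub>m n n"
  then have "P * A = 0\<^sub>m n n" using AB c(1) by simp
  then have "P' * (P * A) = 0\<^sub>m n n" using c(2) by simp
  then show "A = 0\<^sub>m n n" using assoc_mult_mat[OF c(2,1,3)] inv c(3) by simp
qed

lemma outer_eq_0_imp_dot_eq_0:
  assumes "\<And>a b. a < n \<Longrightarrow> b < n \<Longrightarrow> outer u f a b = 0"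
  shows "dot n f u = 0"
proof -
  have "dot n f u = (\<Sum>k<n. outer u f k k)" by (simp add: dot_def outer_def mult.commute)
  then show ?thesis using assms by simp
qed

text \<open>The two derivations satisfy \<open>A^2 = c1 A\<close> and \<open>B^2 = c2 B\<close>;
  intertwining the squares compares \<open>c1\<close> with \<open>c2\<close> on \<open>P A\<close>,
  which is nonzero by faithfulness.\<close>

lemma intertwined_dot_eq:
  fixes u1 f1 u2 f2 :: "nat \<Rightarrow> 'a::field_char_0"
  assumes N: "ext_pow_dim n1 d1 = N" "ext_pow_dim n2 d2 = N"
    and d1: "1 \<le> d1" "d1 < n1"
    and c: "P \<in> carrier_mat N N" "P' \<in> carrier_mat N N"
    and inv: "P' * P = 1\<^sub>m N" "P * P' = 1\<^sub>m N"
    and int: "P * ext_der_mat n1 d1 (outer u1 f1) = ext_der_mat n2 d2 (outer u2 f2) * P"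
    and nz: "dot n1 f1 u1 \<noteq> 0"
  shows "dot n1 f1 u1 = dot n2 f2 u2"
proof -
  let ?A = "ext_der_mat n1 d1 (outer u1 f1)" and ?B = "ext_der_mat n2 d2 (outer u2 f2)"
  let ?c1 = "dot n1 f1 u1" and ?c2 = "dot n2 f2 u2"
  have A: "?A \<in> carrier_mat N N" and B: "?B \<in> carrier_mat N N"
    using N ext_der_mat_carrier by metis+
  have A_nz: "?A \<noteq> 0\<^sub>m N N"
    using ext_der_mat_eq_0_imp[OF d1, of "outer u1 f1"] outer_eq_0_imp_dot_eq_0[of n1 u1 f1] nz N by metis
  have "?c1 \<cdot>\<^sub>m (P * ?A) = P * (?A * ?A)"
    unfolding ext_der_mat_outer_square by (rule mult_smult_distrib[symmetric, OF c(1) A])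
  also have "\<dots> = (P * ?A) * ?A" by (rule assoc_mult_mat[symmetric, OF c(1) A A])
  also have "\<dots> = ?B * (P * ?A)" unfolding int by (rule assoc_mult_mat[OF B c(1) A, unfolded int])
  also have "\<dots> = (?B * ?B) * P" unfolding int by (rule assoc_mult_mat[symmetric, OF B B c(1)])
  also have "\<dots> = ?c2 \<cdot>\<^sub>m (P * ?A)"
    unfolding ext_der_mat_outer_square int by (rule mult_smult_assoc_mat[OF B c(1)])
  finally have eq: "?c1 \<cdot>\<^sub>m (P * ?A) = ?c2 \<cdot>\<^sub>m (P * ?A)" .
  have PA: "P * ?A \<in> carrier_mat N N" using c A by simp
  have "P * ?A \<noteq> 0\<^sub>m N N"
  proof
    assume "P * ?A = 0\<^sub>m N N"
    then have "P' * (P * ?A) = 0\<^sub>m N N" using c by simp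
    then have "?A = 0\<^sub>m N N" using assoc_mult_mat[OF c(2,1) A] inv left_mult_one_mat[OF A] by metis
    then show False using A_nz by simp
  qed
  then obtain i j where ij: "i < N" "j < N" "(P * ?A) $$ (i, j) \<noteq> 0"
    using PA by (metis carrier_matD eq_matI index_zero_mat)
  have "(?c1 \<cdot>\<^sub>m (P * ?A)) $$ (i, j) = (?c2 \<cdot>\<^sub>m (P * ?A)) $$ (i, j)"
    by (simp only: eq)
  then have "?c1 * (P * ?A) $$ (i, j) = ?c2 * (P * ?A) $$ (i, j)"
    using PA ij(1,2) by (metis carrier_matD index_smult_mat(1))
  then show ?thesis using ij(3) by simp
qed

theorem theorem1p3:
  fixes W :: "('g, 'b) monoid_scheme"
    and S :: "'g set"
    and \<rho>1 \<rho>2 :: "'g \<Rightarrow> 'a::field_char_0 mat"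
    and n1 n2 d1 d2 :: nat
  assumes "group W"
    and "S \<subseteq> carrier W" and "finite S" and "generate W S = carrier W"
    and "reflection_rep W S n1 \<rho>1" and "irreducible_rep W n1 \<rho>1"
    and "reflection_rep W S n2 \<rho>2" and "irreducible_rep W n2 \<rho>2"
    and "1 \<le> d1" and "d1 \<le> n1 - 1"
    and "1 \<le> d2" and "d2 \<le> n2 - 1"
    and "iso_rep W (ext_pow_dim n1 d1) (ext_pow_rep n1 d1 \<rho>1)
                   (ext_pow_dim n2 d2) (ext_pow_rep n2 d2 \<rho>2)"
  shows "d1 = d2 \<and> n1 = n2 \<and> iso_rep W n1 \<rho>1 n2 \<rho>2"
proof -
  have d1: "1 \<le> d1" "d1 < n1" and d2: "1 \<le> d2" "d2 < n2" using assms by auto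
  have rep: "is_rep W n1 \<rho>1" "is_rep W n2 \<rho>2" using assms by (auto simp: reflection_rep_def)
  obtain u1 f1 where refl1: "\<And>s. s \<in> S \<Longrightarrow> \<rho>1 s = 1\<^sub>m n1 + mat n1 n1 (\<lambda>(i, j). outer (u1 s) (f1 s) i j)"
    and nz1: "\<And>s. s \<in> S \<Longrightarrow> dot n1 (f1 s) (u1 s) \<noteq> 0"
    and supp1: "\<And>s x. s \<in> S \<Longrightarrow> n1 \<le> x \<Longrightarrow> u1 s x = 0" "\<And>s x. s \<in> S \<Longrightarrow> n1 \<le> x \<Longrightarrow> f1 s x = 0"
    by (rule reflection_repE[OF assms(5)]) (rule that; assumption)
  obtain u2 f2 where refl2: "\<And>s. s \<in> S \<Longrightarrow> \<rho>2 s = 1\<^sub>m n2 + mat n2 n2 (\<lambda>(i, j). outer (u2 s) (f2 s) i j)"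
    and supp2: "\<And>s x. s \<in> S \<Longrightarrow> n2 \<le> x \<Longrightarrow> u2 s x = 0" "\<And>s x. s \<in> S \<Longrightarrow> n2 \<le> x \<Longrightarrow> f2 s x = 0"
    by (rule reflection_repE[OF assms(7)]) (rule that; assumption)
  define N where "N = ext_pow_dim n1 d1"
  obtain P where P: "P \<in> carrier_mat (ext_pow_dim n2 d2) N" "invertible_mat P"
    and P_int: "\<And>w. w \<in> carrier W \<Longrightarrow> P * ext_pow_rep n1 d1 \<rho>1 w = ext_pow_rep n2 d2 \<rho>2 w * P"
    using assms(13) by (auto simp: iso_rep_def N_def)
  \<comment> \<open>Invertibility includes being square, so the exterior powers have equal
    dimension.\<close>
  have N: "ext_pow_dim n1 d1 = N" "ext_pow_dim n2 d2 = N"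
    using P by (auto simp: invertible_mat_def N_def)
  have P_c: "P \<in> carrier_mat N N" using P N by simp
  obtain P' where P': "P * P' = 1\<^sub>m (dim_row P)" "P' * P = 1\<^sub>m (dim_row P')"
    using P(2) by (auto simp: invertible_mat_def inverts_mat_def)
  have P'_c: "P' \<in> carrier_mat N N"
    using arg_cong[OF P'(1), of dim_col] arg_cong[OF P'(2), of dim_col] P_c by auto
  have inv: "P' * P = 1\<^sub>m N" "P * P' = 1\<^sub>m N" using P' P_c P'_c by auto
  \<comment> \<open>At generators the exterior power is the identity plus a derivation, and the
    identity cancels.\<close>
  have int: "P * ext_der_mat n1 d1 (outer (u1 s) (f1 s)) = ext_der_mat n2 d2 (outer (u2 s) (f2 s)) * P"
    if s: "s \<in> S" for s
  proof (rule intertwining_one_plus[OF P_c])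
    show "ext_der_mat n1 d1 (outer (u1 s) (f1 s)) \<in> carrier_mat N N"
      "ext_der_mat n2 d2 (outer (u2 s) (f2 s)) \<in> carrier_mat N N"
      using N ext_der_mat_carrier by metis+
    have "s \<in> carrier W" using s assms by blast
    from P_int[OF this]
    show "P * (1\<^sub>m N + ext_der_mat n1 d1 (outer (u1 s) (f1 s))) = (1\<^sub>m N + ext_der_mat n2 d2 (outer (u2 s) (f2 s))) * P"
      unfolding ext_pow_rep_def refl1[OF s] refl2[OF s] ext_pow_mat_one_plus_outer N .
  qed
  have c_eq: "dot n1 (f1 s) (u1 s) = dot n2 (f2 s) (u2 s)" if "s \<in> S" for s
    using intertwined_dot_eq[OF N d1 P_c P'_c inv int[OF that] nz1[OF that]] .
  obtain s0 where s0: "s0 \<in> S"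
    using generators_nonempty[OF assms(1,2,4,6)] d1 by force
  \<comment> \<open>The trace of a generator's derivation is a binomial times \<open>f(u)\<close>;
    the latter is nonzero and common to both sides, and characteristic 0 recovers the natural
    number.\<close>
  have dims: "n1 = n2 \<and> d1 = d2"
  proof (rule binomial_pair_inj[OF d1 d2])
    show "n1 choose d1 = n2 choose d2" using N by (simp add: ext_pow_dim_eq)
    have tr: "mtrace (ext_der_mat n d (outer u f)) = of_nat ((n - 1) choose (d - 1)) * dot n f u"
      if "1 \<le> d" for n d and u f :: "nat \<Rightarrow> 'a"
      using mtrace_ext_der_mat[OF that, of n "outer u f"] by (simp add: outer_def dot_def mult.commute)
    have "mtrace (ext_der_mat n1 d1 (outer (u1 s0) (f1 s0))) = mtrace (ext_der_mat n2 d2 (outer (u2 s0) (f2 s0)))"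
      by (rule mtrace_conj[OF P_c P'_c inv _ _ int[OF s0]]) (use N ext_der_mat_carrier in metis)+
    then show "(n1 - 1) choose (d1 - 1) = (n2 - 1) choose (d2 - 1)"
      using tr[OF d1(1)] tr[OF d2(1)] c_eq[OF s0] nz1[OF s0] by simp
  qed
  then have n2: "n2 = n1" and d2': "d2 = d1" by auto
  interpret reflection_pair n1 S u1 f1 u2 f2 "ext_intertwined n1 d1 P"
  proof
    fix X X' Y Y' :: "nat \<Rightarrow> nat \<Rightarrow> 'a" and r s
    assume X: "ext_intertwined n1 d1 P X X'"
    show "X = (\<lambda>x y. 0) \<longleftrightarrow> X' = (\<lambda>x y. 0)"
      using intertwined_0_iff[OF P_c P'_c _ _ inv, of "ext_der_mat n1 d1 X" "ext_der_mat n1 d1 X'"] X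
        ext_der_mat_eq_0_iff[OF d1, of X] ext_der_mat_eq_0_iff[OF d1, of X'] N(1)
      by (metis ext_intertwined_def ext_der_mat_carrier)
    show "X' x y = 0" if "n1 \<le> x" for x y
      using X that by (auto simp: ext_intertwined_def mat_supp_def)
    assume Y: "ext_intertwined n1 d1 P Y Y'"
    show "ext_intertwined n1 d1 P (lincomb2 r X s Y) (lincomb2 r X' s Y')"
      using P_c N(1) X Y by (intro ext_intertwined_lincomb2) auto
    show "ext_intertwined n1 d1 P (bracket n1 X Y) (bracket n1 X' Y')"
      using P_c N(1) X Y by (intro ext_intertwined_bracket) auto
  next
    show "ext_intertwined n1 d1 P (outer (u1 i) (f1 i)) (outer (u2 i) (f2 i))" if "i \<in> S" for i
      using int[OF that] supp1[OF that] supp2[OF that]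
      unfolding n2 d2' by (auto simp: ext_intertwined_def mat_supp_def outer_def)
    show "dot n1 (f2 i) (u2 i) = dot n1 (f1 i) (u1 i)" if "i \<in> S" for i
      using c_eq[OF that] unfolding n2 by simp
  next
    fix R :: "(nat \<Rightarrow> 'a) \<Rightarrow> bool" and v0 v :: "nat \<Rightarrow> 'a"
    assume R: "\<And>v w. R v \<Longrightarrow> R w \<Longrightarrow> R (\<lambda>x. v x + w x)" "\<And>r v. R v \<Longrightarrow> R (\<lambda>x. r * v x)"
      "\<And>k v. k \<in> S \<Longrightarrow> R v \<Longrightarrow> R (\<lambda>x. v x + dot n1 (f1 k) v * u1 k x)"
      "R v0" "v0 \<noteq> (\<lambda>x. 0)" "\<And>x. n1 \<le> x \<Longrightarrow> v0 x = 0" "\<And>x. n1 \<le> x \<Longrightarrow> v x = 0"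
    show "R v"
      by (rule irreducible_rep_subspace[OF assms(1,2,4,6) refl1 supp1(1) nz1, of R v0])
        (fact R | assumption)+
  qed (use nz1 d1 supp1 in auto)
  obtain q where q_lin: "\<And>v w r s. \<lbrakk>\<forall>x\<ge>n1. v x = 0; \<forall>x\<ge>n1. w x = 0\<rbrakk> \<Longrightarrow>
       q (\<lambda>x. r * v x + s * w x) = (\<lambda>x. r * q v x + s * q w x)"
    and q_supp: "\<And>v. \<forall>x\<ge>n1. v x = 0 \<Longrightarrow> \<forall>x\<ge>n1. q v x = 0"
    and q_inj: "\<And>v. \<forall>x\<ge>n1. v x = 0 \<Longrightarrow> q v = (\<lambda>x. 0) \<Longrightarrow> v = (\<lambda>x. 0)"
    and q_int: "\<And>k v. k \<in> S \<Longrightarrow> \<forall>x\<ge>n1. v x = 0 \<Longrightarrow>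
       q (\<lambda>x. v x + dot n1 (f1 k) v * u1 k x) = (\<lambda>x. q v x + dot n1 (f2 k) (q v) * u2 k x)"
    using intertwiner by blast
  define Q where "Q = mat n1 n1 (\<lambda>(i, k). q (\<lambda>x. if x = k then 1 else 0) i)"
  have Q: "Q \<in> carrier_mat n1 n1" by (simp add: Q_def)
  have Q_vec: "Q *\<^sub>v vec n1 v = vec n1 (q v)" if "\<forall>x\<ge>n1. v x = 0" for v
    unfolding Q_def by (rule linear_fun_matrix[OF q_lin that])
  have "iso_rep W n1 \<rho>1 n1 \<rho>2"
  proof (rule iso_rep_of_generators[OF assms(1,2,4) rep(1) _ Q])
    show "is_rep W n1 \<rho>2" using rep(2) unfolding n2 .
    show "invertible_mat Q"
    proof (rule invertible_mat_of_injective[OF Q])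
      fix v :: "'a vec" assume v: "v \<in> carrier_vec n1" "Q *\<^sub>v v = 0\<^sub>v n1"
      define w where "w x = (if x < n1 then v $ x else 0)" for x
      have w: "vec n1 w = v" "\<forall>x\<ge>n1. w x = 0" using v by (auto simp: w_def)
      have "vec n1 (q w) = 0\<^sub>v n1" using Q_vec[OF w(2)] v(2) w(1) by simp
      then have "q w x = 0" if "x < n1" for x using that by (auto simp: vec_eq_iff)
      then have "q w = (\<lambda>x. 0)" using q_supp[OF w(2)] by (metis ext linorder_not_less)
      then have "w = (\<lambda>x. 0)" by (rule q_inj[OF w(2)])
      then show "v = 0\<^sub>v n1" using w(1) by auto
    qed
    fix s assume s: "s \<in> S"
    have c: "\<rho>1 s \<in> carrier_mat n1 n1" "\<rho>2 s \<in> carrier_mat n1 n1"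
      using refl1[OF s] refl2[OF s] n2 by auto
    show "Q * \<rho>1 s = \<rho>2 s * Q"
    proof (rule mat_eq_of_mult_vec)
      show "Q * \<rho>1 s \<in> carrier_mat n1 n1" "\<rho>2 s * Q \<in> carrier_mat n1 n1" using Q c by auto
      fix v :: "nat \<Rightarrow> 'a" assume v: "\<forall>x\<ge>n1. v x = 0"
      have "(Q * \<rho>1 s) *\<^sub>v vec n1 v = Q *\<^sub>v (\<rho>1 s *\<^sub>v vec n1 v)"
        by (rule assoc_mult_mat_vec[OF Q c(1)]) simp
      also have "\<dots> = vec n1 (q (\<lambda>x. v x + dot n1 (f1 s) v * u1 s x))"
        unfolding refl1[OF s] one_plus_outer_mult_vec using v supp1[OF s] by (intro Q_vec) auto
      also have "\<dots> = vec n1 (\<lambda>x. q v x + dot n1 (f2 s) (q v) * u2 s x)"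
        by (simp only: q_int[OF s v])
      also have "\<dots> = \<rho>2 s *\<^sub>v (Q *\<^sub>v vec n1 v)"
        unfolding Q_vec[OF v] refl2[OF s, unfolded n2] one_plus_outer_mult_vec ..
      also have "\<dots> = (\<rho>2 s * Q) *\<^sub>v vec n1 v"
        by (rule assoc_mult_mat_vec[symmetric, OF c(2) Q]) simp
      finally show "(Q * \<rho>1 s) *\<^sub>v vec n1 v = (\<rho>2 s * Q) *\<^sub>v vec n1 v" .
    qed
  qed
  then show ?thesis using n2 d2' by simp
qed

end
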